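(* Suppose a virtual link $L$ admits an alternating diagram $D$ without nugatory crossings. Then $L$ is a split virtual link if and only if $D$ is a split diagram.
   Context: A virtual link diagram is an immersion of $m\ge1$ circles in the plane with only double points, each either classical (with over/under information) or virtual. Two diagrams are equivalent if related by planar isotopies, Reidemeister moves and the detour move (an arc containing only virtual crossings may be rerouted arbitrarily, with all its new crossings virtual); a virtual link is an equivalence class. A diagram is alternating if, traveling along each component and disregarding virtual crossings, the classical crossings alternate between over and under. To a virtual link diagram $D$ one associates (Kamada–Kamada) an oriented surface $M_D$ with one $0$-handle (disk neighborhood) for each classical crossing and one $1$-handle for each arc of $D$ from one classical crossing to the next (passing through virtual crossings without interaction; a component with no classical crossings contributes an annulus), and the closed oriented surface $\Sigma_D$ obtained by attaching disks to all boundary components of $M_D$; $D$ becomes a cellularly embedded link diagram on $\Sigma_D$. A classical crossing $c$ of $D$ is nugatory if there is a simple closed curve in (a component of) $\Sigma_D$ which separates it and meets the diagram only in the double point $c$ (passing through $c$ from one corner to the opposite corner). A virtual link diagram is split if it is disconnected, where connectedness is understood disregarding virtual crossings (i.e. $D$ is connected iff $\Sigma_D$ is connected; $D$ is split iff its components can be partitioned into two nonempty families having no classical crossings between them). A virtual link is split if it can be represented by a split diagram. *)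

theory Defs
  imports "HOL-Analysis.Analysis"
begin

section \<open>Virtual link diagrams\<close>

text \<open>
  A diagram is a map of the circles \<open>{i} \<times> sphere 0 1\<close>, \<open>i < ncomp D\<close>, into the plane, together
  with the set \<open>over D\<close> of the points of these circles at which the diagram runs over a classical
  crossing. Double points without a preimage in \<open>over D\<close> are the virtual crossings.
\<close>

record vdiagram =
  ncomp :: nat
  curve :: "nat \<Rightarrow> complex \<Rightarrow> complex"
  over :: "(nat \<times> complex) set"

definition strand_pts :: "vdiagram \<Rightarrow> (nat \<times> complex) set" where
  "strand_pts D = {..<ncomp D} \<times> sphere 0 1"

definition pos :: "vdiagram \<Rightarrow> nat \<times> complex \<Rightarrow> complex" where
  "pos D p = curve D (fst p) (snd p)"

definition tangent :: "vdiagram \<Rightarrow> nat \<times> complex \<Rightarrow> complex" where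
  "tangent D p = vector_derivative (\<lambda>t. curve D (fst p) (cis t)) (at (Arg (snd p)))"

text \<open>\<open>Im (cnj v * w)\<close> is the determinant of the pair \<open>v, w\<close> of plane vectors.\<close>

definition virtual_diagram :: "vdiagram \<Rightarrow> bool" where
  "virtual_diagram D \<longleftrightarrow>
     ncomp D \<ge> 1 \<and>
     (\<forall>i<ncomp D. (\<lambda>t. curve D i (cis t)) C1_differentiable_on UNIV) \<and>
     (\<forall>p\<in>strand_pts D. tangent D p \<noteq> 0) \<and>
     finite {p\<in>strand_pts D. \<exists>q\<in>strand_pts D. q \<noteq> p \<and> pos D q = pos D p} \<and>
     (\<forall>p\<in>strand_pts D. \<forall>q\<in>strand_pts D. \<forall>r\<in>strand_pts D.
        pos D p = pos D q \<and> pos D q = pos D r \<longrightarrow> p = q \<or> q = r \<or> p = r) \<and>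
     (\<forall>p\<in>strand_pts D. \<forall>q\<in>strand_pts D. p \<noteq> q \<and> pos D p = pos D q \<longrightarrow>
        Im (cnj (tangent D p) * tangent D q) \<noteq> 0) \<and>
     over D \<subseteq> strand_pts D \<and>
     (\<forall>p\<in>over D. \<exists>q\<in>strand_pts D - over D. pos D q = pos D p)"

definition under :: "vdiagram \<Rightarrow> (nat \<times> complex) set" where
  "under D = {q \<in> strand_pts D - over D. \<exists>p\<in>over D. pos D p = pos D q}"

definition classical_pts :: "vdiagram \<Rightarrow> (nat \<times> complex) set" where
  "classical_pts D = over D \<union> under D"

definition classical_crossings :: "vdiagram \<Rightarrow> complex set" where
  "classical_crossings D = pos D ` over D"

text \<open>
  \<open>next_classical D p q\<close>: travelling along a component from \<open>p\<close>, the point \<open>q\<close> is the next passage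
  through a classical crossing. If the component has only one such passage, then \<open>q = p\<close>.
\<close>

definition next_classical :: "vdiagram \<Rightarrow> nat \<times> complex \<Rightarrow> nat \<times> complex \<Rightarrow> bool" where
  "next_classical D p q \<longleftrightarrow>
     p \<in> classical_pts D \<and> q \<in> classical_pts D \<and>
     (\<exists>i a b. i < ncomp D \<and> a < b \<and> p = (i, cis a) \<and> q = (i, cis b) \<and>
        (\<forall>t\<in>{a<..<b}. (i, cis t) \<notin> classical_pts D))"

definition alternating :: "vdiagram \<Rightarrow> bool" where
  "alternating D \<longleftrightarrow> (\<forall>p q. next_classical D p q \<longrightarrow> (p \<in> over D \<longleftrightarrow> q \<in> under D))"

definition split_diagram :: "vdiagram \<Rightarrow> bool" where
  "split_diagram D \<longleftrightarrow>
     (\<exists>A B. A \<noteq> {} \<and> B \<noteq> {} \<and> A \<inter> B = {} \<and> A \<union> B = {..<ncomp D} \<and>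
        \<not> (\<exists>p\<in>classical_pts D. \<exists>q\<in>classical_pts D.
              pos D p = pos D q \<and> fst p \<in> A \<and> fst q \<in> B))"


section \<open>Equivalence of diagrams and virtual links\<close>

text \<open>Links are unoriented, and their components are not numbered.\<close>

definition reparametrization :: "vdiagram \<Rightarrow> vdiagram \<Rightarrow> bool" where
  "reparametrization D E \<longleftrightarrow> ncomp E = ncomp D \<and>
     (\<exists>\<sigma> h k. bij_betw \<sigma> {..<ncomp D} {..<ncomp D} \<and>
        (\<forall>i<ncomp D. homeomorphism (sphere 0 1) (sphere 0 1) (h i) (k i) \<and>
           (\<forall>u\<in>sphere 0 1.
              curve E (\<sigma> i) (h i u) = curve D i u \<and>
              ((\<sigma> i, h i u) \<in> over E \<longleftrightarrow> (i, u) \<in> over D))))"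

definition planar_isotopy :: "vdiagram \<Rightarrow> vdiagram \<Rightarrow> bool" where
  "planar_isotopy D E \<longleftrightarrow> ncomp E = ncomp D \<and> over E = over D \<and>
     (\<exists>\<phi>. homotopic_with_canon (\<lambda>f. \<exists>g. homeomorphism UNIV UNIV f g) UNIV UNIV id \<phi> \<and>
        (\<forall>p\<in>strand_pts D. pos E p = \<phi> (pos D p)))"

text \<open>An arc without classical crossings is replaced by any other arc with the same end points;
  since \<open>over\<close> does not change, all crossings on the new arc are virtual.\<close>

definition detour_move :: "vdiagram \<Rightarrow> vdiagram \<Rightarrow> bool" where
  "detour_move D E \<longleftrightarrow> ncomp E = ncomp D \<and> over E = over D \<and>
     (\<exists>i a b. i < ncomp D \<and> a < b \<and> b < a + 2 * pi \<and>
        (\<forall>t\<in>{a..b}. (i, cis t) \<notin> classical_pts D) \<and>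
        (\<forall>p\<in>strand_pts D - (\<lambda>t. (i, cis t)) ` {a..b}. pos E p = pos D p))"

definition square :: "complex set" where
  "square = {z. \<bar>Re z\<bar> \<le> 1 \<and> \<bar>Im z\<bar> \<le> 1}"

text \<open>
  \<open>D\<close> and \<open>E\<close> agree outside an embedded closed disk \<open>h ` square\<close>. Inside, they consist of \<open>n\<close>
  arcs \<open>\<alpha> j\<close>, drawn in the chart \<open>h\<close> as the curves \<open>f j\<close> for \<open>D\<close> and \<open>g j\<close> for \<open>E\<close>, with the over
  points given by the parameters in \<open>F\<close> and \<open>G\<close>. The chart may reverse the orientation, so mirror
  images of the pictures below (with the over/under information kept) are included. Using the same
  arcs \<open>\<alpha> j\<close> for both diagrams is harmless up to planar isotopy and reparametrization.
\<close>

definition local_move ::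
  "nat \<Rightarrow> (nat \<Rightarrow> real \<Rightarrow> complex) \<Rightarrow> (nat \<times> real) set \<Rightarrow>
   (nat \<Rightarrow> real \<Rightarrow> complex) \<Rightarrow> (nat \<times> real) set \<Rightarrow> vdiagram \<Rightarrow> vdiagram \<Rightarrow> bool" where
  "local_move n f F g G D E \<longleftrightarrow> ncomp E = ncomp D \<and>
     (\<exists>h \<alpha> W. continuous_on square h \<and> inj_on h square \<and>
        (\<forall>j<n. continuous_on {-1..1} (\<alpha> j)) \<and>
        inj_on (\<lambda>(j, s). \<alpha> j s) ({..<n} \<times> {-1..1}) \<and>
        W = (\<lambda>(j, s). \<alpha> j s) ` ({..<n} \<times> {-1..1}) \<and>
        {p\<in>strand_pts D. pos D p \<in> h ` square} = W \<and>
        {p\<in>strand_pts E. pos E p \<in> h ` square} = W \<and>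
        (\<forall>p\<in>strand_pts D - W. pos E p = pos D p \<and> (p \<in> over E \<longleftrightarrow> p \<in> over D)) \<and>
        (\<forall>j<n. \<forall>s\<in>{-1..1}.
           pos D (\<alpha> j s) = h (f j s) \<and> (\<alpha> j s \<in> over D \<longleftrightarrow> (j, s) \<in> F) \<and>
           pos E (\<alpha> j s) = h (g j s) \<and> (\<alpha> j s \<in> over E \<longleftrightarrow> (j, s) \<in> G)))"

text \<open>A single strand with exactly one self-crossing, classical of either kind, is straightened.\<close>

definition reidemeister1 :: "vdiagram \<Rightarrow> vdiagram \<Rightarrow> bool" where
  "reidemeister1 D E \<longleftrightarrow>
     (\<exists>\<kappa> s\<^sub>1 s\<^sub>2 s. continuous_on {-1..1} \<kappa> \<and> \<kappa> (-1) = -1 \<and> \<kappa> 1 = 1 \<and>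
        \<kappa> ` {-1<..<1} \<subseteq> interior square \<and>
        -1 < s\<^sub>1 \<and> s\<^sub>1 < s\<^sub>2 \<and> s\<^sub>2 < 1 \<and>
        (\<forall>x\<in>{-1..1}. \<forall>y\<in>{-1..1}. x < y \<longrightarrow> (\<kappa> x = \<kappa> y \<longleftrightarrow> x = s\<^sub>1 \<and> y = s\<^sub>2)) \<and>
        s \<in> {s\<^sub>1, s\<^sub>2} \<and>
        local_move 1 (\<lambda>_. \<kappa>) {(0, s)} (\<lambda>_. complex_of_real) {} D E)"

text \<open>The graph of \<open>u\<close> meets the real axis twice and the graph of \<open>v\<close> does not meet it; the strand
  \<open>m\<close> is over at both crossings.\<close>

definition reidemeister2 :: "vdiagram \<Rightarrow> vdiagram \<Rightarrow> bool" where
  "reidemeister2 D E \<longleftrightarrow>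
     (\<exists>u v m. continuous_on {-1..1} u \<and> continuous_on {-1..1} v \<and>
        (\<forall>s\<in>{-1..1}. \<bar>u s\<bar> < 1 \<and> 0 < v s \<and> v s < 1) \<and>
        u (-1) = v (-1) \<and> u 1 = v 1 \<and>
        card {s\<in>{-1..1}. u s = 0} = 2 \<and> m \<in> {0, 1} \<and>
        local_move 2
          (\<lambda>j s. if j = 0 then Complex s 0 else Complex s (u s)) ({m} \<times> {s\<in>{-1..1}. u s = 0})
          (\<lambda>j s. if j = 0 then Complex s 0 else Complex s (v s)) {}
          D E)"

text \<open>
  The middle strand \<open>Im z = Re z / 2\<close> crosses over the bottom strand \<open>Im z = - Re z / 2\<close> at \<open>0\<close>; the
  top strand, the graph of \<open>u\<close> or \<open>v\<close>, passes on different sides of this crossing.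
\<close>

definition reidemeister3 :: "vdiagram \<Rightarrow> vdiagram \<Rightarrow> bool" where
  "reidemeister3 D E \<longleftrightarrow>
     (\<exists>u v. continuous_on {-1..1} u \<and> continuous_on {-1..1} v \<and>
        (\<forall>s\<in>{-1..1}. \<bar>u s\<bar> < 1 \<and> \<bar>v s\<bar> < 1) \<and>
        u (-1) = v (-1) \<and> u 1 = v 1 \<and> \<bar>u (-1)\<bar> < 1/2 \<and> \<bar>u 1\<bar> < 1/2 \<and>
        0 < u 0 \<and> v 0 < 0 \<and>
        (\<exists>!s. s \<in> {-1..1} \<and> u s = s/2) \<and> (\<exists>!s. s \<in> {-1..1} \<and> u s = - s/2) \<and>
        (\<exists>!s. s \<in> {-1..1} \<and> v s = s/2) \<and> (\<exists>!s. s \<in> {-1..1} \<and> v s = - s/2) \<and>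
        local_move 3
          (\<lambda>j s. Complex s (if j = 0 then u s else if j = 1 then s/2 else - s/2))
          ({0} \<times> {s\<in>{-1..1}. u s = s/2 \<or> u s = - s/2} \<union> {(1, 0)})
          (\<lambda>j s. Complex s (if j = 0 then v s else if j = 1 then s/2 else - s/2))
          ({0} \<times> {s\<in>{-1..1}. v s = s/2 \<or> v s = - s/2} \<union> {(1, 0)})
          D E)"

definition diagram_move :: "vdiagram \<Rightarrow> vdiagram \<Rightarrow> bool" where
  "diagram_move D E \<longleftrightarrow> virtual_diagram D \<and> virtual_diagram E \<and>
     (reparametrization D E \<or> planar_isotopy D E \<or> detour_move D E \<or>
      reidemeister1 D E \<or> reidemeister2 D E \<or> reidemeister3 D E)"

definition diagram_equiv :: "vdiagram \<Rightarrow> vdiagram \<Rightarrow> bool" where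
  "diagram_equiv = equivclp diagram_move"

definition virtual_link :: "vdiagram set \<Rightarrow> bool" where
  "virtual_link L \<longleftrightarrow>
     (\<exists>D. virtual_diagram D \<and> L = {E. virtual_diagram E \<and> diagram_equiv D E})"

definition split_link :: "vdiagram set \<Rightarrow> bool" where
  "split_link L \<longleftrightarrow> (\<exists>D\<in>L. split_diagram D)"


section \<open>The closed surface of a diagram\<close>

text \<open>
  The surface is glued from one square \<open>{Inl c} \<times> square\<close> for each classical crossing \<open>c\<close> and one
  square \<open>{Inr i} \<times> square\<close> for each component \<open>i\<close> without classical crossings.

  The square of \<open>c\<close> contains the diagram as its two axes, the overcrossing strand running along the
  real axis, and each side is glued, preserving orientations, to the side met by the other end of
  the same arc. The central squares \<open>\<bar>Re z\<bar>, \<bar>Im z\<bar> \<le> 1/2\<close> are the 0-handles, the regions between them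
  and the middle halves of the sides form the 1-handles, and the remaining corner squares fit
  together around the vertices of the tiling to form the disks attached to the boundary components.

  The square of \<open>i\<close> contains the diagram as the real axis. Its left and right sides are glued, which
  makes the band \<open>\<bar>Im z\<bar> \<le> 1/2\<close> an annulus, and its top and bottom sides are folded, which makes the
  rest two disks attached to this annulus.
\<close>

type_synonym tile_pt = "(complex + nat) \<times> complex"

definition tiles :: "vdiagram \<Rightarrow> (complex + nat) set" where
  "tiles D = Inl ` classical_crossings D \<union>
     Inr ` {i. i < ncomp D \<and> (\<forall>u. (i, u) \<notin> classical_pts D)}"

definition tile_space :: "vdiagram \<Rightarrow> tile_pt topology" where
  "tile_space D = prod_topology (discrete_topology (tiles D)) (top_of_set square)"

text \<open>
  The direction, in the square of its crossing, in which the strand leaves at a classical passage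
  \<open>p\<close>; it arrives from the opposite direction. For an undercrossing this is chosen such that the
  cyclic order of the four ends in the square is the one in the plane.
\<close>

definition out_dir :: "vdiagram \<Rightarrow> nat \<times> complex \<Rightarrow> complex" where
  "out_dir D p =
     (if p \<in> over D then 1
      else let q = (THE q. q \<in> over D \<and> pos D q = pos D p)
           in \<i> * of_real (sgn (Im (cnj (tangent D q) * tangent D p))))"

text \<open>For a unit \<open>d\<close> in \<open>{1, \<i>, -1, -\<i>}\<close>, the points \<open>d * (1 + \<i> * y)\<close>, \<open>y \<in> {-1..1}\<close>, form the side in
  direction \<open>d\<close>, parametrized counterclockwise.\<close>

inductive glue :: "vdiagram \<Rightarrow> tile_pt \<Rightarrow> tile_pt \<Rightarrow> bool" for D where
  arc: "next_classical D p q \<Longrightarrow> y \<in> {-1..1} \<Longrightarrow>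
    glue D (Inl (pos D p), out_dir D p * (1 + \<i> * of_real y))
           (Inl (pos D q), - out_dir D q * (1 - \<i> * of_real y))"
| annulus: "Inr i \<in> tiles D \<Longrightarrow> y \<in> {-1..1} \<Longrightarrow> glue D (Inr i, Complex 1 y) (Inr i, Complex (-1) y)"
| cap: "Inr i \<in> tiles D \<Longrightarrow> x \<in> {-1..1} \<Longrightarrow> y \<in> {-1, 1} \<Longrightarrow>
    glue D (Inr i, Complex x y) (Inr i, Complex (- x) y)"

definition surf_pt :: "vdiagram \<Rightarrow> tile_pt \<Rightarrow> tile_pt set" where
  "surf_pt D x = {y. equivclp (glue D) x y}"

definition surface :: "vdiagram \<Rightarrow> tile_pt set topology" where
  "surface D = topology (\<lambda>U. U \<subseteq> surf_pt D ` topspace (tile_space D) \<and>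
     openin (tile_space D) {x \<in> topspace (tile_space D). surf_pt D x \<in> U})"

lemma openin_surface:
  "openin (surface D) U \<longleftrightarrow> U \<subseteq> surf_pt D ` topspace (tile_space D) \<and>
     openin (tile_space D) {x \<in> topspace (tile_space D). surf_pt D x \<in> U}"
proof -
  let ?T = "topspace (tile_space D)"
  have "istopology (\<lambda>U. U \<subseteq> surf_pt D ` ?T \<and> openin (tile_space D) {x \<in> ?T. surf_pt D x \<in> U})"
    unfolding istopology_def
  proof (intro conjI allI impI)
    fix S S'
    assume "S \<subseteq> surf_pt D ` ?T \<and> openin (tile_space D) {x \<in> ?T. surf_pt D x \<in> S}"
      and "S' \<subseteq> surf_pt D ` ?T \<and> openin (tile_space D) {x \<in> ?T. surf_pt D x \<in> S'}"
    moreover have "{x \<in> ?T. surf_pt D x \<in> S \<inter> S'} =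
        {x \<in> ?T. surf_pt D x \<in> S} \<inter> {x \<in> ?T. surf_pt D x \<in> S'}"
      by auto
    ultimately show "openin (tile_space D) {x \<in> ?T. surf_pt D x \<in> S \<inter> S'}" by auto
  next
    fix \<K> assume "\<forall>K\<in>\<K>. K \<subseteq> surf_pt D ` ?T \<and> openin (tile_space D) {x \<in> ?T. surf_pt D x \<in> K}"
    moreover have "{x \<in> ?T. surf_pt D x \<in> \<Union>\<K>} = (\<Union>K\<in>\<K>. {x \<in> ?T. surf_pt D x \<in> K})"
      by auto
    ultimately show "openin (tile_space D) {x \<in> ?T. surf_pt D x \<in> \<Union>\<K>}"
      by auto
  qed auto
  then show ?thesis by (simp add: surface_def)
qed

definition surface_diagram :: "vdiagram \<Rightarrow> tile_pt set set" where
  "surface_diagram D =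
     surf_pt D ` {(\<tau>, z). \<tau> \<in> tiles D \<and> z \<in> square \<and> (Im z = 0 \<or> Re z = 0 \<and> \<tau> \<in> range Inl)}"

definition quadrant :: "complex \<Rightarrow> complex set" where
  "quadrant d = {z\<in>square. Re z * Re d > 0 \<and> Im z * Im d > 0}"

text \<open>The corner \<open>d\<close> is one of \<open>1 + \<i>, -1 + \<i>, -1 - \<i>, 1 - \<i>\<close>; the curve \<open>\<gamma>\<close> leaves the crossing through
  this corner and returns through the opposite one.\<close>

definition nugatory :: "vdiagram \<Rightarrow> complex \<Rightarrow> bool" where
  "nugatory D c \<longleftrightarrow> c \<in> classical_crossings D \<and>
     (let x = surf_pt D (Inl c, 0);
          C = connected_component_of_set (surface D) x in
      \<exists>\<gamma>. pathin (surface D) \<gamma> \<and> \<gamma> 0 = x \<and> \<gamma> 1 = x \<and> inj_on \<gamma> {0..<1} \<and>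
        \<gamma> ` {0..1} \<inter> surface_diagram D = {x} \<and>
        (\<exists>d \<epsilon>. Re d \<in> {-1, 1} \<and> Im d \<in> {-1, 1} \<and> 0 < \<epsilon> \<and> \<epsilon> < 1 \<and>
           (\<forall>t\<in>{0<..<\<epsilon>}. \<gamma> t \<in> surf_pt D ` ({Inl c} \<times> quadrant d)) \<and>
           (\<forall>t\<in>{1 - \<epsilon><..<1}. \<gamma> t \<in> surf_pt D ` ({Inl c} \<times> quadrant (- d)))) \<and>
        \<not> connectedin (surface D) (C - \<gamma> ` {0..1}))"

end

theory Submission
  imports Defs
begin

text \<open>
  A real Fox coloring of a diagram assigns a real number to every arc from one undercrossing to the
  next such that at each crossing the two arcs of the lower strand have the upper color as their
  mean. The existence of a nonconstant coloring is invariant under diagram equivalence, and a split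
  diagram has one, with value 1 on one part and 0 on the other. Conversely, in an alternating
  diagram every arc with ends passes over exactly one crossing. For a crossing with lower
  colors \<open>l, r\<close> and upper color \<open>o = (l + r) / 2\<close> we have \<open>(l - r)\<^sup>2 = 2 l\<^sup>2 + 2 r\<^sup>2 - 4 o\<^sup>2\<close>, and in the
  sum over all crossings each of \<open>l\<close>, \<open>r\<close>, \<open>o\<close> runs once over all these arcs. So this sum vanishes, every
  coloring is constant along components and across crossings, and a nonconstant one splits the
  diagram.
\<close>

text \<open>Real coefficients are essential: the argument needs that a vanishing sum of squares has
  vanishing terms. Over a finite field it breaks down: the trefoil is alternating and not split, but
  has a nonconstant coloring mod 3. Virtual crossings impose no condition, so a coloring sees only
  which points of the circles form classical crossings. The work is in the invariance. The moves are
  given by merely continuous arcs and parametrizations, and they change the set of arcs of a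
  diagram. A coloring that is a function on the points of the circles survives this, because it can
  be left untouched outside the disk of a move. Giving an under point the mean of its two sides
  separates the crossing condition into a local statement about one-sided values and the equality of
  the colors of the two points of a crossing. Inside a disk, colorings are then constants plus
  multiples of functions \<open>sgn (s - x)\<close>, and each Reidemeister move becomes linear
  algebra in the coefficients.\<close>

text \<open>
  Colorings are functions of the points of the circles. The value at a jump is the mean of the
  one-sided values; at an undercrossing this is the color of the upper strand. The flag \<open>b\<close> says
  whether \<open>\<phi>\<close> may jump at \<open>s\<close>.
\<close>

definition node :: "(real \<Rightarrow> real) \<Rightarrow> real \<Rightarrow> bool \<Rightarrow> bool" where
  "node \<phi> s b \<longleftrightarrow> (\<exists>l r. (\<forall>\<^sub>F t in at_left s. \<phi> t = l) \<and> (\<forall>\<^sub>F t in at_right s. \<phi> t = r) \<and>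
     l + r = 2 * \<phi> s \<and> (\<not> b \<longrightarrow> l = r))"

lemma nodeI:
  "\<lbrakk>\<forall>\<^sub>F t in at_left s. \<phi> t = l; \<forall>\<^sub>F t in at_right s. \<phi> t = r; l + r = 2 * \<phi> s; \<not> b \<longrightarrow> l = r\<rbrakk>
    \<Longrightarrow> node \<phi> s b"
  unfolding node_def by blast

lemma nodeE:
  assumes "node \<phi> s b"
  obtains l r where "\<forall>\<^sub>F t in at_left s. \<phi> t = l" "\<forall>\<^sub>F t in at_right s. \<phi> t = r"
    "l + r = 2 * \<phi> s" "\<not> b \<longrightarrow> l = r"
  using assms unfolding node_def by auto

lemma node_False_iff: "node \<phi> s False \<longleftrightarrow> (\<forall>\<^sub>F t in at s. \<phi> t = \<phi> s)"
proof
  assume "node \<phi> s False"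
  then obtain l r where "\<forall>\<^sub>F t in at_left s. \<phi> t = l" "\<forall>\<^sub>F t in at_right s. \<phi> t = r"
      "l + r = 2 * \<phi> s" "l = r"
    unfolding node_def by auto
  then show "\<forall>\<^sub>F t in at s. \<phi> t = \<phi> s" by (simp add: eventually_at_split)
next
  assume "\<forall>\<^sub>F t in at s. \<phi> t = \<phi> s"
  then show "node \<phi> s False" by (intro nodeI[where l="\<phi> s" and r="\<phi> s"]) (auto simp: eventually_at_split)
qed

lemma node_mono: "node \<phi> s b \<Longrightarrow> (b \<Longrightarrow> b') \<Longrightarrow> node \<phi> s b'"
  unfolding node_def by blast

lemma node_const: "node (\<lambda>_. c) s b"
  by (rule nodeI[where l=c and r=c]) auto

lemma node_add:
  assumes "node \<phi> s b" "node \<psi> s b'"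
  shows "node (\<lambda>t. \<phi> t + \<psi> t) s (b \<or> b')"
proof -
  from assms(1) obtain l r where 1: "\<forall>\<^sub>F t in at_left s. \<phi> t = l" "\<forall>\<^sub>F t in at_right s. \<phi> t = r"
      "l + r = 2 * \<phi> s" "\<not> b \<longrightarrow> l = r"
    by (rule nodeE)
  from assms(2) obtain l' r' where 2: "\<forall>\<^sub>F t in at_left s. \<psi> t = l'" "\<forall>\<^sub>F t in at_right s. \<psi> t = r'"
      "l' + r' = 2 * \<psi> s" "\<not> b' \<longrightarrow> l' = r'"
    by (rule nodeE)
  show ?thesis
  proof (rule nodeI)
    show "\<forall>\<^sub>F t in at_left s. \<phi> t + \<psi> t = l + l'"
      using 1(1) 2(1) by eventually_elim simp
    show "\<forall>\<^sub>F t in at_right s. \<phi> t + \<psi> t = r + r'"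
      using 1(2) 2(2) by eventually_elim simp
  qed (use 1(3,4) 2(3,4) in auto)
qed

lemma node_scale_sgn: "node (\<lambda>t. c * sgn (t - x)) s (s = x)"
proof (cases s x rule: linorder_cases)
  case less
  have "node (\<lambda>t. c * sgn (t - x)) s False"
    unfolding node_False_iff eventually_at_topological
    using less by (intro exI[of _ "{..<x}"]) auto
  then show ?thesis by (rule node_mono) simp
next
  case greater
  have "node (\<lambda>t. c * sgn (t - x)) s False"
    unfolding node_False_iff eventually_at_topological
    using greater by (intro exI[of _ "{x<..}"]) auto
  then show ?thesis by (rule node_mono) simp
next
  case equal
  then show ?thesis
    by (intro nodeI[where l="-c" and r=c]) (auto simp: eventually_at_filter)
qed

lemma node_cong:
  assumes "node \<phi> s b" "\<forall>\<^sub>F t in at s. \<psi> t = \<phi> t" "\<psi> s = \<phi> s"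
  shows "node \<psi> s b"
proof -
  from assms(1) obtain l r where 1: "\<forall>\<^sub>F t in at_left s. \<phi> t = l" "\<forall>\<^sub>F t in at_right s. \<phi> t = r"
      "l + r = 2 * \<phi> s" "\<not> b \<longrightarrow> l = r"
    by (rule nodeE)
  have 2: "\<forall>\<^sub>F t in at_left s. \<psi> t = \<phi> t" "\<forall>\<^sub>F t in at_right s. \<psi> t = \<phi> t"
    using assms(2) by (auto simp: eventually_at_split)
  show ?thesis
  proof (rule nodeI)
    show "\<forall>\<^sub>F t in at_left s. \<psi> t = l"
      using 1(1) 2(1) by eventually_elim simp
    show "\<forall>\<^sub>F t in at_right s. \<psi> t = r"
      using 1(2) 2(2) by eventually_elim simp
  qed (use 1(3,4) assms(3) in auto)
qed

lemma node_cong_open: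
  assumes "node \<phi> s b" "open S" "s \<in> S" "\<And>t. t \<in> S \<Longrightarrow> \<psi> t = \<phi> t"
  shows "node \<psi> s b"
proof (rule node_cong[OF assms(1)])
  show "\<forall>\<^sub>F t in at s. \<psi> t = \<phi> t"
    unfolding eventually_at_topological using assms by (intro exI[of _ S]) auto
qed (use assms in auto)

section \<open>Functions with finitely many jumps on an interval\<close>

lemma locally_constant_interval:
  fixes \<phi> :: "real \<Rightarrow> real"
  assumes "\<And>s. s \<in> {a<..<b} \<Longrightarrow> node \<phi> s False"
  shows "\<exists>c. \<forall>s\<in>{a<..<b}. \<phi> s = c"
proof -
  have "\<phi> constant_on {a<..<b}"
  proof (rule locally_constant_imp_constant)
    fix s assume s: "s \<in> {a<..<b}"
    have "\<exists>S. open S \<and> s \<in> S \<and> (\<forall>x\<in>S. x \<noteq> s \<longrightarrow> \<phi> x = \<phi> s)"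
      using assms[OF s] by (simp add: node_False_iff eventually_at_topological)
    then obtain S where "open S" "s \<in> S" "\<forall>x\<in>S. x \<noteq> s \<longrightarrow> \<phi> x = \<phi> s"
      by (elim exE conjE)
    then show "\<exists>T. openin (top_of_set {a<..<b}) T \<and> s \<in> T \<and> (\<forall>x\<in>T. \<phi> x = \<phi> s)"
      using s by (intro exI[of _ "{a<..<b} \<inter> S"]) (auto simp: openin_open)
  qed simp
  then show ?thesis by (simp add: constant_on_def)
qed

text \<open>Induction on the set of jumps: adding a suitable multiple of \<open>sgn (s - x)\<close>
  removes the jump at \<open>x\<close>, and without jumps the function is constant on the
  interval.\<close>

lemma node_step_function:
  fixes \<phi> :: "real \<Rightarrow> real"
  assumes "finite S" "S \<subseteq> {a<..<b}" "\<And>s. s \<in> {a<..<b} \<Longrightarrow> node \<phi> s (s \<in> S)"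
  shows "\<exists>k c. \<forall>s\<in>{a<..<b}. \<phi> s = k + (\<Sum>x\<in>S. c x * sgn (s - x))"
  using assms
proof (induction S arbitrary: \<phi> rule: finite_induct)
  case empty
  then have "\<exists>k. \<forall>s\<in>{a<..<b}. \<phi> s = k"
    using locally_constant_interval[of a b \<phi>] by auto
  then show ?case by simp
next
  case (insert x S)
  have x: "x \<in> {a<..<b}" using insert.prems by auto
  from insert.prems(2)[OF x] obtain l r where lr: "\<forall>\<^sub>F t in at_left x. \<phi> t = l"
      "\<forall>\<^sub>F t in at_right x. \<phi> t = r" "l + r = 2 * \<phi> x"
    by (rule nodeE)
  \<comment> \<open>Both one-sided values of \<open>\<psi>\<close> at \<open>x\<close> are
    \<open>(l + r) / 2 = \<phi> x\<close>, and the added term is 0 at \<open>x\<close>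
    itself.\<close>
  define \<psi> where "\<psi> = (\<lambda>t. \<phi> t + (l - r) / 2 * sgn (t - x))"
  have "node \<psi> s (s \<in> S)" if s: "s \<in> {a<..<b}" for s
  proof (cases "s = x")
    case True
    have left: "\<forall>\<^sub>F t in at_left x. t < x" and right: "\<forall>\<^sub>F t in at_right x. x < t"
      by (simp_all add: eventually_at_filter)
    have "\<forall>\<^sub>F t in at_left x. \<psi> t = \<psi> x"
      using lr(1) left by eventually_elim (use lr(3) in \<open>simp add: \<psi>_def field_simps\<close>)
    moreover have "\<forall>\<^sub>F t in at_right x. \<psi> t = \<psi> x"
      using lr(2) right by eventually_elim (use lr(3) in \<open>simp add: \<psi>_def field_simps\<close>)
    ultimately have "node \<psi> x False"
      by (simp add: node_False_iff eventually_at_split)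
    then show ?thesis using True node_mono[of \<psi> x False] by simp
  next
    case False
    show ?thesis
      unfolding \<psi>_def
      by (rule node_mono[OF node_add[OF insert.prems(2)[OF s] node_scale_sgn]])
        (use False in auto)
  qed
  then obtain k c where kc: "\<forall>s\<in>{a<..<b}. \<psi> s = k + (\<Sum>x\<in>S. c x * sgn (s - x))"
    using insert.IH[of \<psi>] insert.prems(1) by auto
  have "\<phi> s = k + (\<Sum>y\<in>insert x S. (c(x := (r - l) / 2)) y * sgn (s - y))" if "s \<in> {a<..<b}" for s
  proof -
    have "(\<Sum>y\<in>S. (c(x := (r - l) / 2)) y * sgn (s - y)) = (\<Sum>x\<in>S. c x * sgn (s - x))"
      using insert.hyps by (intro sum.cong) auto
    then show ?thesis using kc that insert.hyps by (auto simp: \<psi>_def field_simps)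
  qed
  then show ?case by blast
qed

section \<open>Change of parameter on the line and on the circle\<close>

lemma node_compose_mono:
  fixes g :: "real \<Rightarrow> real"
  assumes g: "continuous_on {a..b} g" "strict_mono_on {a..b} g" and s: "s \<in> {a<..<b}"
  shows "node (\<lambda>t. \<phi> (g t)) s e \<longleftrightarrow> node \<phi> (g s) e"
proof -
  have less: "g x < g y \<longleftrightarrow> x < y" if "x \<in> {a..b}" "y \<in> {a..b}" for x y
    using strict_mono_on_less[OF g(2)] that by blast
  \<comment> \<open>From left to right, every \<open>y\<close> just below \<open>g s\<close> is a
    value of \<open>g\<close> by the intermediate value theorem; from right to left, continuity
    keeps \<open>g t\<close> close to \<open>g s\<close>. Both directions matter, since colorings
    are carried from the circle into a disk and back.\<close>
  have L: "(\<forall>\<^sub>F t in at_left s. P (g t)) \<longleftrightarrow> (\<forall>\<^sub>F y in at_left (g s). P y)" for P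
  proof
    assume "\<forall>\<^sub>F t in at_left s. P (g t)"
    then obtain c where c: "c < s" "\<And>t. c < t \<Longrightarrow> t < s \<Longrightarrow> P (g t)"
      by (auto simp: eventually_at_left_field)
    define d where "d = max a c"
    have d: "a \<le> d" "d < s" "c \<le> d" using c s by (auto simp: d_def)
    have "P y" if y: "g d < y" "y < g s" for y
    proof -
      have "continuous_on {d..s} g" using g(1) by (rule continuous_on_subset) (use d s in auto)
      then obtain t where t: "d \<le> t" "t \<le> s" "g t = y"
        using IVT'[of g d y s] y d by auto
      then have "d < t" "t < s" using y by (auto simp: order.order_iff_strict)
      then show ?thesis using c(2)[of t] t d by auto
    qed
    moreover have "g d < g s" using less d s by auto
    ultimately show "\<forall>\<^sub>F y in at_left (g s). P y" by (auto simp: eventually_at_left_field)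
  next
    assume "\<forall>\<^sub>F y in at_left (g s). P y"
    then obtain c where c: "c < g s" "\<And>y. c < y \<Longrightarrow> y < g s \<Longrightarrow> P y"
      by (auto simp: eventually_at_left_field)
    have "isCont g s" using g(1) s by (simp add: continuous_on_interior)
    then have "\<forall>\<^sub>F t in at s. c < g t" using c(1) by (auto simp: isCont_def intro: order_tendstoD)
    then have "\<forall>\<^sub>F t in at_left s. c < g t" by (simp add: eventually_at_split)
    moreover have "\<forall>\<^sub>F t in at_left s. a < t \<and> t < s"
      using s by (auto simp: eventually_at_left_field)
    ultimately show "\<forall>\<^sub>F t in at_left s. P (g t)"
      by eventually_elim (use c(2) less s in auto)
  qed
  have R: "(\<forall>\<^sub>F t in at_right s. P (g t)) \<longleftrightarrow> (\<forall>\<^sub>F y in at_right (g s). P y)" for P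
  proof
    assume "\<forall>\<^sub>F t in at_right s. P (g t)"
    then obtain c where c: "c > s" "\<And>t. s < t \<Longrightarrow> t < c \<Longrightarrow> P (g t)"
      by (auto simp: eventually_at_right_field)
    define d where "d = min b c"
    have d: "d \<le> b" "s < d" "d \<le> c" using c s by (auto simp: d_def)
    have "P y" if y: "g s < y" "y < g d" for y
    proof -
      have "continuous_on {s..d} g" using g(1) by (rule continuous_on_subset) (use d s in auto)
      then obtain t where t: "s \<le> t" "t \<le> d" "g t = y"
        using IVT'[of g s y d] y d by auto
      then have "s < t" "t < d" using y by (auto simp: order.order_iff_strict)
      then show ?thesis using c(2)[of t] t d by auto
    qed
    moreover have "g s < g d" using less d s by auto
    ultimately show "\<forall>\<^sub>F y in at_right (g s). P y" by (auto simp: eventually_at_right_field)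
  next
    assume "\<forall>\<^sub>F y in at_right (g s). P y"
    then obtain c where c: "c > g s" "\<And>y. g s < y \<Longrightarrow> y < c \<Longrightarrow> P y"
      by (auto simp: eventually_at_right_field)
    have "isCont g s" using g(1) s by (simp add: continuous_on_interior)
    then have "\<forall>\<^sub>F t in at s. g t < c" using c(1) by (auto simp: isCont_def intro: order_tendstoD)
    then have "\<forall>\<^sub>F t in at_right s. g t < c" by (simp add: eventually_at_split)
    moreover have "\<forall>\<^sub>F t in at_right s. s < t \<and> t < b"
      using s by (auto simp: eventually_at_right_field)
    ultimately show "\<forall>\<^sub>F t in at_right s. P (g t)"
      by eventually_elim (use c(2) less s in auto)
  qed
  show ?thesis
    unfolding node_def using L[of "\<lambda>y. \<phi> y = _"] R[of "\<lambda>y. \<phi> y = _"] by (simp only:)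
qed

text \<open>The reflection exchanges the two sides, and \<open>node\<close> is symmetric in
  \<open>l\<close> and \<open>r\<close>.\<close>

lemma node_uminus: "node (\<lambda>t. \<phi> (- t)) (- s) e \<longleftrightarrow> node \<phi> s e"
proof -
  have "node (\<lambda>t. \<phi> (- t)) (- s) e" if n: "node \<phi> s e" for \<phi> s
  proof -
    from n obtain l r where "\<forall>\<^sub>F t in at_left s. \<phi> t = l" "\<forall>\<^sub>F t in at_right s. \<phi> t = r"
        "l + r = 2 * \<phi> s" "\<not> e \<longrightarrow> l = r"
      by (rule nodeE)
    then show ?thesis
      by (intro nodeI[where l=r and r=l])
        (auto simp: at_left_minus[of "-s"] at_right_minus[of "-s"] eventually_filtermap)
  qed
  from this[of \<phi> s] this[of "\<lambda>t. \<phi> (- t)" "- s"] show ?thesis by auto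
qed

text \<open>An injective continuous function on an interval is strictly monotone; the decreasing
  case reduces to the increasing one by a reflection.\<close>

lemma node_compose:
  fixes g :: "real \<Rightarrow> real"
  assumes g: "continuous_on {a..b} g" "inj_on g {a..b}" and s: "s \<in> {a<..<b}"
  shows "node (\<lambda>t. \<phi> (g t)) s e \<longleftrightarrow> node \<phi> (g s) e"
proof -
  have "strict_mono_on {a..b} g \<or> strict_antimono_on {a..b} g"
    using injective_eq_monotone_map[of "{a..b}" g] g is_interval_cc[of a b] by blast
  then show ?thesis
  proof
    assume "strict_mono_on {a..b} g"
    then show ?thesis using node_compose_mono g s by blast
  next
    assume "strict_antimono_on {a..b} g"
    then have "strict_mono_on {a..b} (\<lambda>t. - g t)"
      by (simp add: monotone_on_def)
    from node_compose_mono[OF _ this s, of "\<lambda>t. \<phi> (- t)" e] show ?thesis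
      using g(1) node_uminus[of \<phi> "g s" e] by (simp add: continuous_on_minus)
  qed
qed

text \<open>The interval is contractible, so a path avoiding 0 has a continuous logarithm. On the
  unit circle this logarithm is purely imaginary, and its imaginary part is the angle.\<close>

lemma circle_path_angle:
  fixes \<gamma> :: "real \<Rightarrow> complex"
  assumes "continuous_on {a..b} \<gamma>" "inj_on \<gamma> {a..b}" "\<gamma> ` {a..b} \<subseteq> sphere 0 1"
  obtains g where "continuous_on {a..b} g" "inj_on g {a..b}" "\<And>t. t \<in> {a..b} \<Longrightarrow> \<gamma> t = cis (g t)"
proof -
  have nz: "\<gamma> t \<noteq> 0" if "t \<in> {a..b}" for t using assms(3) that by force
  obtain h where h: "continuous_on {a..b} h" "\<And>t. t \<in> {a..b} \<Longrightarrow> \<gamma> t = exp (h t)"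
    using continuous_logarithm_on_contractible[OF assms(1) convex_imp_contractible nz] by auto
  have "\<gamma> t = cis (Im (h t))" if "t \<in> {a..b}" for t
  proof -
    have "norm (\<gamma> t) = 1" using assms(3) that by force
    then have "Re (h t) = 0" using h(2)[OF that] by (simp add: norm_exp_eq_Re)
    then show ?thesis using h(2)[OF that] by (simp add: exp_eq_polar)
  qed
  moreover have "continuous_on {a..b} (\<lambda>t. Im (h t))" using h(1) by (intro continuous_intros)
  moreover have "inj_on (\<lambda>t. Im (h t)) {a..b}"
    using assms(2) calculation(1) by (metis (no_types, lifting) inj_on_def)
  ultimately show ?thesis using that by blast
qed

text \<open>An injective path in the circle traces \<open>cis\<close> monotonically, so the arcs of local moves and
  reparametrizations, which are merely continuous, preserve the local condition.\<close>

lemma node_arc: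
  assumes "continuous_on {a..b} \<gamma>" "inj_on \<gamma> {a..b}" "\<gamma> ` {a..b} \<subseteq> sphere 0 1"
    and "s \<in> {a<..<b}" "\<gamma> s = cis \<theta>"
  shows "node (\<lambda>t. F (\<gamma> t)) s e \<longleftrightarrow> node (\<lambda>t. F (cis t)) \<theta> e"
proof -
  obtain g where g: "continuous_on {a..b} g" "inj_on g {a..b}" "\<And>t. t \<in> {a..b} \<Longrightarrow> \<gamma> t = cis (g t)"
    using circle_path_angle assms by blast
  \<comment> \<open>The lifted angle at \<open>s\<close> may differ from \<open>\<theta>\<close> by
    a multiple of \<open>2 * pi\<close>, so the lift is shifted to take the value
    \<open>\<theta>\<close> there.\<close>
  have "cis (g s) = cis \<theta>" using g(3)[of s] assms(4,5) by auto
  then obtain n :: int where "g s = \<theta> + 2 * pi * n"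
    using sin_cos_eq_iff[of "g s" \<theta>] by (auto simp: complex_eq_iff)
  then have n: "g s - 2 * pi * n = \<theta>" by simp
  have eq: "cis (g t - 2 * pi * n) = \<gamma> t" if "t \<in> {a..b}" for t
    using g(3)[OF that] by (simp add: cis_divide[symmetric] cis_multiple_2pi)
  have "node (\<lambda>t. F (\<gamma> t)) s e \<longleftrightarrow> node (\<lambda>t. F (cis (g t - 2 * pi * n))) s e"
    using assms(4) eq
    by (auto intro: node_cong_open[where S="{a<..<b}"])
  also have "\<dots> \<longleftrightarrow> node (\<lambda>t. F (cis t)) (g s - 2 * pi * n) e"
  proof (rule node_compose)
    show "continuous_on {a..b} (\<lambda>t. g t - 2 * pi * n)" using g(1) by (intro continuous_intros)
    show "inj_on (\<lambda>t. g t - 2 * pi * n) {a..b}" using g(2) by (simp add: inj_on_def)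
  qed (use assms(4) in auto)
  finally show ?thesis by (simp add: n)
qed

section \<open>Colorings\<close>

text \<open>The pairs consist of the over point and the under point of a classical crossing.\<close>

definition crossing_rel :: "vdiagram \<Rightarrow> ((nat \<times> complex) \<times> (nat \<times> complex)) set" where
  "crossing_rel D = {(p, q). p \<in> over D \<and> q \<in> strand_pts D \<and> q \<noteq> p \<and> pos D q = pos D p}"

text \<open>At an under point \<open>q\<close>, \<open>node\<close> makes \<open>f q\<close> the
  mean of the colors on its two sides, so \<open>f q = f p\<close> is the Fox relation with upper
  color \<open>f p\<close>. Jumps are permitted nowhere else; in particular both strands of a
  virtual crossing keep their colors.\<close>

definition coloring :: "vdiagram \<Rightarrow> (nat \<times> complex \<Rightarrow> real) \<Rightarrow> bool" where
  "coloring D f \<longleftrightarrow>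
     (\<forall>i<ncomp D. \<forall>\<theta>. node (\<lambda>t. f (i, cis t)) \<theta> ((i, cis \<theta>) \<in> snd ` crossing_rel D)) \<and>
     (\<forall>p q. (p, q) \<in> crossing_rel D \<longrightarrow> f q = f p)"

definition colorable :: "vdiagram \<Rightarrow> bool" where
  "colorable D \<longleftrightarrow> (\<exists>f. coloring D f \<and> \<not> f constant_on strand_pts D)"

lemma coloring_crossing: "\<lbrakk>coloring D f; (p, q) \<in> crossing_rel D\<rbrakk> \<Longrightarrow> f q = f p"
  unfolding coloring_def by blast

lemma unit_circle_cis:
  assumes "z \<in> sphere 0 1" obtains \<theta> where "z = cis \<theta>"
  using assms rcis_cmod_Arg[of z] that[of "Arg z"] by (simp add: cis_rcis_eq)

lemma cis_eqE:
  assumes "cis x = cis y" obtains n :: int where "x = y + 2 * pi * n"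
  using assms sin_cos_eq_iff[of x y] by (auto simp: complex_eq_iff)

lemma cis_add_period [simp]: "cis (x + 2 * pi * of_int n) = cis x"
  using cis_mult[of x "2 * pi * of_int n"] cis_multiple_2pi[of "of_int n"] by simp

lemma strand_ptsE:
  assumes "p \<in> strand_pts D" obtains i \<theta> where "i < ncomp D" "p = (i, cis \<theta>)"
proof -
  have "fst p < ncomp D" "snd p \<in> sphere 0 1" using assms by (auto simp: strand_pts_def)
  moreover obtain \<theta> where "snd p = cis \<theta>" using calculation(2) by (rule unit_circle_cis)
  ultimately show ?thesis using that by (metis prod.collapse)
qed

lemma cis_in_strand_pts [simp]: "(i, cis \<theta>) \<in> strand_pts D \<longleftrightarrow> i < ncomp D"
  by (simp add: strand_pts_def)

section \<open>Crossings as a matching of over points and under points\<close>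

context
  fixes D assumes vd: "virtual_diagram D"
begin

lemma over_strand: "over D \<subseteq> strand_pts D"
  using vd by (simp add: virtual_diagram_def)

lemma no_triple_point:
  "\<lbrakk>p \<in> strand_pts D; q \<in> strand_pts D; r \<in> strand_pts D; pos D p = pos D q; pos D q = pos D r\<rbrakk>
    \<Longrightarrow> p = q \<or> q = r \<or> p = r"
  using vd unfolding virtual_diagram_def by (elim conjE) simp

lemma over_partner: "p \<in> over D \<Longrightarrow> \<exists>q\<in>strand_pts D - over D. pos D q = pos D p"
  using vd unfolding virtual_diagram_def by (elim conjE) (rule bspec)

lemma crossing_relD:
  assumes "(p, q) \<in> crossing_rel D"
  shows "p \<in> strand_pts D" "q \<in> strand_pts D" "q \<noteq> p" "pos D q = pos D p"
  using assms over_strand by (auto simp: crossing_rel_def)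

text \<open>The over point has some partner outside \<open>over D\<close>, and a double point has
  only two preimages, so this partner is \<open>q\<close>.\<close>

lemma crossing_rel_under:
  assumes "(p, q) \<in> crossing_rel D" shows "p \<in> over D" "q \<in> under D"
proof -
  show p: "p \<in> over D" using assms by (simp add: crossing_rel_def)
  obtain q' where q': "q' \<in> strand_pts D" "q' \<notin> over D" "pos D q' = pos D p"
    using over_partner[OF p] by blast
  have "p \<noteq> q'" using p q' by blast
  moreover have "q = p \<or> p = q' \<or> q = q'"
    by (rule no_triple_point) (simp_all add: crossing_relD[OF assms] q')
  ultimately have "q = q'" using crossing_relD(3)[OF assms] by blast
  then show "q \<in> under D"
    unfolding under_def using p q' by (intro CollectI conjI bexI[of _ p]) simp_all
qed

lemma under_iff_crossing_rel: "q \<in> under D \<longleftrightarrow> q \<in> snd ` crossing_rel D"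
proof
  assume "q \<in> under D"
  then obtain p where p: "p \<in> over D" "pos D p = pos D q" "q \<in> strand_pts D - over D"
    unfolding under_def by blast
  then have "q \<noteq> p" by blast
  then have "(p, q) \<in> crossing_rel D" using p by (simp add: crossing_rel_def)
  then show "q \<in> snd ` crossing_rel D" by (rule image_eqI[rotated]) simp
next
  assume "q \<in> snd ` crossing_rel D"
  then obtain p where "(p, q) \<in> crossing_rel D" by auto
  then show "q \<in> under D" by (rule crossing_rel_under)
qed

text \<open>Three points of the circles at one double point cannot all differ. Together with
  \<open>crossing_rel_under_unique\<close>, \<open>over_crossing_rel\<close> and
  \<open>under_iff_crossing_rel\<close> this makes \<open>crossing_rel D\<close> the graph of a
  bijection from over to under points.\<close>

lemma crossing_rel_over_unique:
  assumes "(p, q) \<in> crossing_rel D" "(p', q) \<in> crossing_rel D" shows "p = p'"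
proof -
  have "p = q \<or> q = p' \<or> p = p'"
    by (rule no_triple_point) (use crossing_relD[OF assms(1)] crossing_relD[OF assms(2)] in simp_all)
  then show ?thesis using crossing_relD(3)[OF assms(1)] crossing_relD(3)[OF assms(2)] by blast
qed

lemma crossing_rel_under_unique:
  assumes "(p, q) \<in> crossing_rel D" "(p, q') \<in> crossing_rel D" shows "q = q'"
proof -
  have "q = p \<or> p = q' \<or> q = q'"
    by (rule no_triple_point) (use crossing_relD[OF assms(1)] crossing_relD[OF assms(2)] in simp_all)
  then show ?thesis using crossing_relD(3)[OF assms(1)] crossing_relD(3)[OF assms(2)] by blast
qed

lemma over_crossing_rel:
  assumes "p \<in> over D" shows "\<exists>q. (p, q) \<in> crossing_rel D"
proof -
  obtain q where "q \<in> strand_pts D - over D" "pos D q = pos D p"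
    using over_partner[OF assms] by blast
  then show ?thesis using assms by (intro exI[of _ q]) (auto simp: crossing_rel_def)
qed

lemma classical_pair_crossing:
  assumes "p \<in> classical_pts D" "q \<in> classical_pts D" "p \<noteq> q" "pos D p = pos D q"
  shows "(p, q) \<in> crossing_rel D \<or> (q, p) \<in> crossing_rel D"
proof (cases "p \<in> over D")
  case True
  then show ?thesis using assms over_strand by (auto simp: crossing_rel_def classical_pts_def under_def)
next
  case False
  then obtain r where r: "r \<in> over D" "pos D r = pos D p" "p \<in> strand_pts D" "p \<noteq> r"
    using assms by (auto simp: classical_pts_def under_def)
  have "q \<in> strand_pts D" using assms over_strand by (auto simp: classical_pts_def under_def)
  moreover have "r \<in> strand_pts D" using r over_strand by blast
  moreover have "pos D p = pos D q" "pos D q = pos D r" using r assms by simp_all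
  ultimately have "p = q \<or> q = r \<or> p = r"
    using r(3) by (intro no_triple_point)
  then have "q = r" using r assms by blast
  then show ?thesis using r by (auto simp: crossing_rel_def)
qed

lemma classical_pts_strand: "classical_pts D \<subseteq> strand_pts D"
  using over_strand by (auto simp: classical_pts_def under_def)

lemma finite_classical_pts: "finite (classical_pts D)"
proof (rule finite_subset)
  show "finite {p\<in>strand_pts D. \<exists>q\<in>strand_pts D. q \<noteq> p \<and> pos D q = pos D p}"
    using vd by (simp add: virtual_diagram_def)
  show "classical_pts D \<subseteq> \<dots>"
  proof
    fix p assume p: "p \<in> classical_pts D"
    then consider "p \<in> over D" | "p \<in> under D" by (auto simp: classical_pts_def)
    then have "\<exists>q\<in>strand_pts D. q \<noteq> p \<and> pos D q = pos D p"
    proof cases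
      case 1
      then show ?thesis using over_partner by fastforce
    next
      case 2
      then show ?thesis using over_strand by (force simp: under_def)
    qed
    then show "p \<in> {p\<in>strand_pts D. \<exists>q\<in>strand_pts D. q \<noteq> p \<and> pos D q = pos D p}"
      using p classical_pts_strand by auto
  qed
qed

section \<open>Consecutive classical passages along a component\<close>

lemma next_classical_exists:
  assumes "p \<in> classical_pts D"
  shows "\<exists>q. next_classical D p q"
proof -
  obtain i a where ia: "i < ncomp D" "p = (i, cis a)"
    using assms classical_pts_strand strand_ptsE by (metis subsetD)
  \<comment> \<open>The half-open window of one full turn contains \<open>a + 2 * pi\<close>, that
    is, \<open>p\<close> itself. So \<open>S\<close> is never empty, and \<open>p\<close> is its own
    successor if the component has no other classical passage.\<close>
  define S where "S = {t\<in>{a<..a + 2 * pi}. (i, cis t) \<in> classical_pts D}"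
  have "inj_on (\<lambda>t. (i, cis t)) S"
  proof (rule inj_onI)
    fix x y assume xy: "x \<in> S" "y \<in> S" "(i, cis x) = (i, cis y)"
    then obtain n :: int where n: "x = y + 2 * pi * n" by (auto elim: cis_eqE)
    have "\<bar>2 * pi * n\<bar> < 2 * pi" using xy n by (auto simp: S_def)
    then have "\<bar>real_of_int n\<bar> < 1" by (simp add: abs_mult)
    then show "x = y" using n by simp
  qed
  moreover have "finite ((\<lambda>t. (i, cis t)) ` S)"
    by (rule finite_subset[OF _ finite_classical_pts]) (auto simp: S_def)
  ultimately have fin: "finite S" using finite_imageD by blast
  have "a + 2 * pi \<in> S" using assms ia cis_add_period[of a 1] by (auto simp: S_def)
  then have ne: "S \<noteq> {}" by blast
  define b where "b = Min S"
  have b: "b \<in> S" using Min_in[OF fin ne] by (simp add: b_def)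
  have "(i, cis t) \<notin> classical_pts D" if "t \<in> {a<..<b}" for t
  proof
    assume "(i, cis t) \<in> classical_pts D"
    then have "t \<in> S" using that b by (auto simp: S_def)
    then show False using Min_le[OF fin] that by (fastforce simp: b_def)
  qed
  then have "next_classical D p (i, cis b)"
    unfolding next_classical_def using assms ia b
    by (intro conjI exI[of _ i] exI[of _ a] exI[of _ b]) (auto simp: S_def)
  then show ?thesis by blast
qed

end

text \<open>Two arcs that end at \<open>q\<close> can be shifted by a multiple of
  \<open>2 * pi\<close> to have the same end parameter. If their starts differed, the later one
  would be a classical passage strictly inside the other arc.\<close>

lemma next_classical_inj:
  assumes "next_classical D p q" "next_classical D p' q"
  shows "p = p'"
proof -
  obtain i a b where 1: "p = (i, cis a)" "q = (i, cis b)" "a < b"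
      "\<And>t. t \<in> {a<..<b} \<Longrightarrow> (i, cis t) \<notin> classical_pts D"
    using assms(1) unfolding next_classical_def by blast
  obtain a' b' where 2: "p' = (i, cis a')" "q = (i, cis b')" "a' < b'"
      "\<And>t. t \<in> {a'<..<b'} \<Longrightarrow> (i, cis t) \<notin> classical_pts D"
    using assms(2) 1(2) unfolding next_classical_def by auto
  obtain n :: int where n: "b' = b + 2 * pi * n" using 1(2) 2(2) by (auto elim: cis_eqE)
  have cl: "(i, cis a) \<in> classical_pts D" "(i, cis a') \<in> classical_pts D"
    using assms 1 2 by (auto simp: next_classical_def)
  have "\<not> a < a' - 2 * pi * n"
  proof
    assume "a < a' - 2 * pi * n"
    then have "a' - 2 * pi * n \<in> {a<..<b}" using 2(3) n by auto
    then show False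
      using 1(4) cl(2) cis_add_period[of a' "- n"] by fastforce
  qed
  moreover have "\<not> a' < a + 2 * pi * n"
  proof
    assume "a' < a + 2 * pi * n"
    then have "a + 2 * pi * n \<in> {a'<..<b'}" using 1(3) n by auto
    then show False
      using 2(4) cl(1) cis_add_period[of a n] by fastforce
  qed
  ultimately have "a' = a + 2 * pi * n" by linarith
  then show ?thesis using 1 2 by simp
qed

text \<open>The angle is quantified because arcs of \<open>next_classical\<close> reach the same
  point at angles that differ by full turns. By \<open>left_val_unique\<close> and
  \<open>right_val_unique\<close> the value does not depend on it.\<close>

definition left_val :: "(nat \<times> complex \<Rightarrow> real) \<Rightarrow> nat \<times> complex \<Rightarrow> real \<Rightarrow> bool" where
  "left_val f p l \<longleftrightarrow> (\<exists>\<theta>. snd p = cis \<theta> \<and> (\<forall>\<^sub>F t in at_left \<theta>. f (fst p, cis t) = l))"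

definition right_val :: "(nat \<times> complex \<Rightarrow> real) \<Rightarrow> nat \<times> complex \<Rightarrow> real \<Rightarrow> bool" where
  "right_val f p r \<longleftrightarrow> (\<exists>\<theta>. snd p = cis \<theta> \<and> (\<forall>\<^sub>F t in at_right \<theta>. f (fst p, cis t) = r))"

lemma left_val_unique:
  assumes "left_val f p l" "left_val f p l'" shows "l = l'"
proof -
  obtain x y a b where xy: "snd p = cis x" "snd p = cis y" and a: "a < x" "b < y"
      "\<And>t. a < t \<Longrightarrow> t < x \<Longrightarrow> f (fst p, cis t) = l"
      "\<And>t. b < t \<Longrightarrow> t < y \<Longrightarrow> f (fst p, cis t) = l'"
    using assms by (auto simp: left_val_def eventually_at_left_field)
  have "cis x = cis y" using xy by simp
  then obtain n :: int where n: "x = y + 2 * pi * n" by (rule cis_eqE)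
  obtain t where t: "max a (b + 2 * pi * n) < t" "t < x"
    using dense[of "max a (b + 2 * pi * n)" x] a n by auto
  have "cis (t - 2 * pi * n) = cis t" using cis_add_period[of t "- n"] by simp
  then show ?thesis using a(3)[of t] a(4)[of "t - 2 * pi * n"] t n by auto
qed

lemma right_val_unique:
  assumes "right_val f p l" "right_val f p l'" shows "l = l'"
proof -
  obtain x y a b where xy: "snd p = cis x" "snd p = cis y" and a: "a > x" "b > y"
      "\<And>t. x < t \<Longrightarrow> t < a \<Longrightarrow> f (fst p, cis t) = l"
      "\<And>t. y < t \<Longrightarrow> t < b \<Longrightarrow> f (fst p, cis t) = l'"
    using assms by (auto simp: right_val_def eventually_at_right_field)
  have "cis x = cis y" using xy by simp
  then obtain n :: int where n: "x = y + 2 * pi * n" by (rule cis_eqE)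
  obtain t where t: "min a (b + 2 * pi * n) > t" "t > x"
    using dense[of x "min a (b + 2 * pi * n)"] a n by auto
  have "cis (t - 2 * pi * n) = cis t" using cis_add_period[of t "- n"] by simp
  then show ?thesis using a(3)[of t] a(4)[of "t - 2 * pi * n"] t n by auto
qed

text \<open>No under point lies strictly between \<open>p\<close> and \<open>q\<close>, so the
  coloring is locally constant and hence constant on the open arc.\<close>

lemma next_classical_val:
  assumes "virtual_diagram D" "coloring D f" "next_classical D p q"
  obtains v where "right_val f p v" "left_val f q v"
proof -
  obtain i a b where 1: "i < ncomp D" "p = (i, cis a)" "q = (i, cis b)" "a < b"
      "\<And>t. t \<in> {a<..<b} \<Longrightarrow> (i, cis t) \<notin> classical_pts D"
    using assms(3) unfolding next_classical_def by auto
  have "node (\<lambda>t. f (i, cis t)) t False" if "t \<in> {a<..<b}" for t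
  proof -
    have "(i, cis t) \<notin> snd ` crossing_rel D"
      using 1(5)[OF that] under_iff_crossing_rel[OF assms(1)] by (auto simp: classical_pts_def)
    moreover have "node (\<lambda>t. f (i, cis t)) t ((i, cis t) \<in> snd ` crossing_rel D)"
      using assms(2) 1(1) by (simp add: coloring_def)
    ultimately show ?thesis by simp
  qed
  then obtain v where v: "\<forall>t\<in>{a<..<b}. f (i, cis t) = v"
    using locally_constant_interval[of a b "\<lambda>t. f (i, cis t)"] by auto
  have "right_val f p v"
    unfolding right_val_def using v 1
    by (intro exI[of _ a]) (auto simp: eventually_at_right_field intro: exI[of _ b])
  moreover have "left_val f q v"
    unfolding left_val_def using v 1
    by (intro exI[of _ b]) (auto simp: eventually_at_left_field intro: exI[of _ a])
  ultimately show ?thesis using that by blast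
qed

section \<open>Colorings of alternating diagrams, and split diagrams\<close>

lemma alternating_coloring_locally_constant:
  assumes vd: "virtual_diagram D" and alt: "alternating D" and f: "coloring D f" and i: "i < ncomp D"
  shows "node (\<lambda>t. f (i, cis t)) \<theta> False"
proof -
  let ?O = "over D" and ?U = "under D"
  have "\<forall>p\<in>strand_pts D. \<exists>l r. left_val f p l \<and> right_val f p r \<and> l + r = 2 * f p \<and>
      (p \<notin> ?U \<longrightarrow> l = r)"
  proof
    fix p assume "p \<in> strand_pts D"
    then obtain i \<theta> where p: "i < ncomp D" "p = (i, cis \<theta>)" by (rule strand_ptsE)
    have "node (\<lambda>t. f (i, cis t)) \<theta> (p \<in> ?U)"
      using f p under_iff_crossing_rel[OF vd] unfolding coloring_def by auto
    then show "\<exists>l r. left_val f p l \<and> right_val f p r \<and> l + r = 2 * f p \<and> (p \<notin> ?U \<longrightarrow> l = r)"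
      unfolding left_val_def right_val_def p by (elim nodeE) auto
  qed
  from bchoice[OF this] obtain l where "\<forall>p\<in>strand_pts D. \<exists>r. left_val f p (l p) \<and>
      right_val f p r \<and> l p + r = 2 * f p \<and> (p \<notin> ?U \<longrightarrow> l p = r)"
    by (elim exE)
  from bchoice[OF this] obtain r where "\<forall>p\<in>strand_pts D. left_val f p (l p) \<and>
      right_val f p (r p) \<and> l p + r p = 2 * f p \<and> (p \<notin> ?U \<longrightarrow> l p = r p)"
    by (elim exE)
  then have lr: "\<And>p. p \<in> strand_pts D \<Longrightarrow> left_val f p (l p)"
      "\<And>p. p \<in> strand_pts D \<Longrightarrow> right_val f p (r p)"
      "\<And>p. p \<in> strand_pts D \<Longrightarrow> l p + r p = 2 * f p"
      "\<And>p. p \<in> strand_pts D \<Longrightarrow> p \<notin> ?U \<Longrightarrow> l p = r p"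
    by auto
  have sub: "?O \<subseteq> strand_pts D" "?U \<subseteq> strand_pts D" "?O \<inter> ?U = {}"
    using over_strand[OF vd] by (auto simp: under_def)
  have fin: "finite ?O" "finite ?U"
    using finite_classical_pts[OF vd] by (auto simp: classical_pts_def)
  define N where "N = (\<lambda>p. SOME q. next_classical D p q)"
  have N: "next_classical D p (N p)" if "p \<in> ?O \<union> ?U" for p
    unfolding N_def using next_classical_exists[OF vd] that by (metis classical_pts_def someI_ex)
  have rN: "r p = l (N p)" if p: "p \<in> ?O \<union> ?U" for p
  proof -
    obtain v where "right_val f p v" "left_val f (N p) v"
      using next_classical_val[OF vd f N[OF p]] .
    moreover have "N p \<in> strand_pts D" "p \<in> strand_pts D"
      using N[OF p] classical_pts_strand[OF vd] by (auto simp: next_classical_def)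
    ultimately show ?thesis using lr left_val_unique right_val_unique by metis
  qed
  have inj: "inj_on N (?O \<union> ?U)"
    using N next_classical_inj by (metis inj_onI)
  \<comment> \<open>Alternation enters here: the successor of an over passage is an under passage
    and vice versa.\<close>
  have NO: "N ` ?O \<subseteq> ?U" and NU: "N ` ?U \<subseteq> ?O"
    using N alt sub(3) unfolding alternating_def next_classical_def classical_pts_def by blast+
  have injO: "inj_on N ?O" and injU: "inj_on N ?U" using inj inj_on_subset by blast+
  \<comment> \<open>Injections in both directions make the two finite sets equally large, so both
    injections are onto and can be used to reindex sums.\<close>
  have card: "card ?O = card ?U"
    using card_inj_on_le[OF injO NO] card_inj_on_le[OF injU NU] fin by auto
  have eqO: "N ` ?O = ?U" using card_subset_eq[OF fin(2) NO] card_image[OF injO] card by simp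
  have eqU: "N ` ?U = ?O" using card_subset_eq[OF fin(1) NU] card_image[OF injU] card by simp
  \<comment> \<open>While \<open>N\<close> follows the strands, \<open>u\<close> changes from the
    upper to the lower strand of a crossing. Of the three sums below, those of the one-sided values
    are reindexed by \<open>N\<close>, that of the crossing colors by \<open>u\<close>.\<close>
  define u where "u = (\<lambda>p. SOME q. (p, q) \<in> crossing_rel D)"
  have u: "(p, u p) \<in> crossing_rel D" if "p \<in> ?O" for p
    unfolding u_def using over_crossing_rel[OF vd that] by (rule someI_ex)
  have injo: "inj_on u ?O" using u crossing_rel_over_unique[OF vd] by (metis inj_onI)
  have uO: "u ` ?O \<subseteq> ?U" using u crossing_rel_under[OF vd] by blast
  have equ: "u ` ?O = ?U" using card_subset_eq[OF fin(2) uO] card_image[OF injo] card by simp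
  have fu: "f (u p) = f p" if "p \<in> ?O" for p using coloring_crossing[OF f u[OF that]] .
  have lO: "l p = f p" "r p = f p" if "p \<in> ?O" for p
  proof -
    have "p \<in> strand_pts D" "p \<notin> ?U" using that sub by auto
    then show "l p = f p" "r p = f p" using lr(3,4)[of p] by auto
  qed
  \<comment> \<open>The successor map \<open>N\<close> exchanges over and under points, and colors are constant from \<open>p\<close> to \<open>N p\<close>.\<close>
  have "(\<Sum>q\<in>?U. (l q)\<^sup>2) = (\<Sum>p\<in>?O. (l (N p))\<^sup>2)"
    unfolding eqO[symmetric] by (simp add: sum.reindex[OF injO])
  also have "\<dots> = (\<Sum>p\<in>?O. (f p)\<^sup>2)"
    using rN lO(2) by (intro sum.cong) auto
  finally have 1: "(\<Sum>q\<in>?U. (l q)\<^sup>2) = (\<Sum>p\<in>?O. (f p)\<^sup>2)" .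
  have "(\<Sum>q\<in>?U. (r q)\<^sup>2) = (\<Sum>q\<in>?U. (l (N q))\<^sup>2)"
    using rN by (intro sum.cong) auto
  also have "\<dots> = (\<Sum>p\<in>?O. (l p)\<^sup>2)"
    unfolding eqU[symmetric] by (simp add: sum.reindex[OF injU])
  also have "\<dots> = (\<Sum>p\<in>?O. (f p)\<^sup>2)" using lO by simp
  finally have 2: "(\<Sum>q\<in>?U. (r q)\<^sup>2) = (\<Sum>p\<in>?O. (f p)\<^sup>2)" .
  have "(\<Sum>q\<in>?U. (f q)\<^sup>2) = (\<Sum>p\<in>?O. (f (u p))\<^sup>2)"
    unfolding equ[symmetric] by (simp add: sum.reindex[OF injo])
  then have 3: "(\<Sum>q\<in>?U. (f q)\<^sup>2) = (\<Sum>p\<in>?O. (f p)\<^sup>2)" using fu by simp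
  have "(\<Sum>q\<in>?U. (l q - r q)\<^sup>2) = (\<Sum>q\<in>?U. 2 * (l q)\<^sup>2 + 2 * (r q)\<^sup>2 - 4 * (f q)\<^sup>2)"
  proof (rule sum.cong)
    fix q assume "q \<in> ?U"
    then have "f q = (l q + r q) / 2" using lr(3)[of q] sub by auto
    then show "(l q - r q)\<^sup>2 = 2 * (l q)\<^sup>2 + 2 * (r q)\<^sup>2 - 4 * (f q)\<^sup>2"
      by (simp only: power2_eq_square) (simp add: algebra_simps)
  qed simp
  also have "\<dots> = 2 * (\<Sum>q\<in>?U. (l q)\<^sup>2) + 2 * (\<Sum>q\<in>?U. (r q)\<^sup>2) - 4 * (\<Sum>q\<in>?U. (f q)\<^sup>2)"
    by (simp only: sum.distrib sum_subtractf sum_distrib_left)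
  also have "\<dots> = 0" using 1 2 3 by simp
  finally have "\<forall>q\<in>?U. (l q - r q)\<^sup>2 = 0"
    using sum_nonneg_eq_0_iff[OF fin(2), of "\<lambda>q. (l q - r q)\<^sup>2"] by simp
  then have eq: "l q = r q" if "q \<in> ?U" for q using that by simp
  let ?p = "(i, cis \<theta>)"
  have "l ?p = r ?p" using eq lr(4) i by (cases "?p \<in> ?U") auto
  have n: "node (\<lambda>t. f (i, cis t)) \<theta> (?p \<in> snd ` crossing_rel D)"
    using f i unfolding coloring_def by blast
  then obtain l' r' where l': "\<forall>\<^sub>F t in at_left \<theta>. f (i, cis t) = l'"
     "\<forall>\<^sub>F t in at_right \<theta>. f (i, cis t) = r'" "l' + r' = 2 * f ?p"
    by (rule nodeE)
  have "left_val f ?p l'" "right_val f ?p r'"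
    using l' by (auto simp: left_val_def right_val_def)
  then have "l' = r'"
    using \<open>l ?p = r ?p\<close> lr(1,2)[of ?p] i left_val_unique right_val_unique by (metis cis_in_strand_pts)
  with l' show ?thesis by (intro nodeI[where l=l' and r=r']) simp_all
qed

lemma component_constant:
  assumes "\<And>\<theta>. node (\<lambda>t. f (i, cis t)) \<theta> False"
  shows "\<exists>c. \<forall>\<theta>. f (i, cis \<theta>) = c"
proof -
  \<comment> \<open>This open interval contains all values of \<open>Arg\<close>, which range from
    \<open>- pi\<close> to \<open>pi\<close>.\<close>
  obtain c where c: "\<forall>\<theta>\<in>{-4<..<4}. f (i, cis \<theta>) = c"
    using locally_constant_interval[of "-4" 4 "\<lambda>t. f (i, cis t)"] assms by auto
  have "f (i, cis \<theta>) = c" for \<theta>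
  proof -
    have "Arg (cis \<theta>) \<in> {-4<..<4}"
      using Arg_bounded[of "cis \<theta>"] pi_less_4 by auto
    then show ?thesis using bspec[OF c, of "Arg (cis \<theta>)"] cis_Arg[of "cis \<theta>"] by (simp add: sgn_eq)
  qed
  then show ?thesis by blast
qed

lemma alternating_colorable_split:
  assumes vd: "virtual_diagram D" and "alternating D" "colorable D"
  shows "split_diagram D"
proof -
  obtain f where f: "coloring D f" "\<not> f constant_on strand_pts D"
    using assms(3) by (auto simp: colorable_def)
  have "\<exists>c. \<forall>\<theta>. f (i, cis \<theta>) = c" if "i < ncomp D" for i
    using component_constant[of f i] alternating_coloring_locally_constant[OF vd assms(2) f(1) that]
    by simp
  then obtain c where c: "\<And>i \<theta>. i < ncomp D \<Longrightarrow> f (i, cis \<theta>) = c i" by metis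
  have fc: "f p = c (fst p)" if "p \<in> strand_pts D" for p
  proof -
    obtain i \<theta> where "i < ncomp D" "p = (i, cis \<theta>)" using \<open>p \<in> _\<close> by (rule strand_ptsE)
    then show ?thesis using c by simp
  qed
  have "0 < ncomp D" using vd by (simp add: virtual_diagram_def)
  \<comment> \<open>The components are sorted by whether they have the color of component 0.
    Nonconstancy puts some component into \<open>B\<close>, and crossings join only components of
    equal color.\<close>
  define A where "A = {i. i < ncomp D \<and> c i = c 0}"
  define B where "B = {i. i < ncomp D \<and> c i \<noteq> c 0}"
  have neA: "A \<noteq> {}" using \<open>0 < ncomp D\<close> by (auto simp: A_def)
  have neB: "B \<noteq> {}"
  proof
    assume "B = {}"
    then have "f p = c 0" if "p \<in> strand_pts D" for p
    proof -
      have "fst p < ncomp D" using that by (auto simp: strand_pts_def)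
      moreover have "fst p \<notin> B" using \<open>B = {}\<close> by simp
      ultimately have "c (fst p) = c 0" unfolding B_def by blast
      then show ?thesis using fc[OF that] by simp
    qed
    then have "f constant_on strand_pts D" unfolding constant_on_def by (intro exI ballI)
    then show False using f by blast
  qed
  have AB: "A \<inter> B = {}" "A \<union> B = {..<ncomp D}" by (auto simp: A_def B_def)
  have False
    if pq: "p \<in> classical_pts D" "q \<in> classical_pts D" "pos D p = pos D q" "fst p \<in> A" "fst q \<in> B" for p q
  proof -
    have "p \<noteq> q" using pq by (auto simp: A_def B_def)
    then have "(p, q) \<in> crossing_rel D \<or> (q, p) \<in> crossing_rel D"
      using classical_pair_crossing[OF vd pq(1,2) _ pq(3)] by simp
    then have "f p = f q" using coloring_crossing[OF f(1), of p q] coloring_crossing[OF f(1), of q p] by auto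
    moreover have "p \<in> strand_pts D" "q \<in> strand_pts D"
      using pq classical_pts_strand[OF vd] by auto
    ultimately have "c (fst p) = c (fst q)" using fc[of p] fc[of q] by simp
    then show False using pq(4,5) by (simp add: A_def B_def)
  qed
  then have no: "\<not> (\<exists>p\<in>classical_pts D. \<exists>q\<in>classical_pts D. pos D p = pos D q \<and> fst p \<in> A \<and> fst q \<in> B)"
    by auto
  show ?thesis unfolding split_diagram_def
    using neA neB AB no by (intro exI[of _ A] exI[of _ B] conjI)
qed

lemma split_colorable:
  assumes vd: "virtual_diagram D" and "split_diagram D"
  shows "colorable D"
proof -
  obtain A B where AB: "A \<noteq> {}" "B \<noteq> {}" "A \<inter> B = {}" "A \<union> B = {..<ncomp D}"
    and no: "\<not> (\<exists>p\<in>classical_pts D. \<exists>q\<in>classical_pts D. pos D p = pos D q \<and> fst p \<in> A \<and> fst q \<in> B)"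
    using assms(2) unfolding split_diagram_def by (elim exE conjE)
  define f :: "nat \<times> complex \<Rightarrow> real" where "f = (\<lambda>p. if fst p \<in> A then 1 else 0)"
  have "f q = f p" if "(p, q) \<in> crossing_rel D" for p q
  proof -
    have cl: "p \<in> classical_pts D" "q \<in> classical_pts D"
      using crossing_rel_under[OF vd that] by (auto simp: classical_pts_def)
    then have "p \<in> strand_pts D" "q \<in> strand_pts D" using classical_pts_strand[OF vd] by auto
    then have "fst p \<in> A \<union> B" "fst q \<in> A \<union> B"
      unfolding AB(4) by (auto simp: strand_pts_def)
    moreover have "\<not> (fst p \<in> A \<and> fst q \<in> B)" "\<not> (fst q \<in> A \<and> fst p \<in> B)"
      using no cl crossing_relD(4)[OF vd that] by metis+
    ultimately have "fst p \<in> A \<longleftrightarrow> fst q \<in> A" by blast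
    then show ?thesis by (simp add: f_def)
  qed
  moreover have "node (\<lambda>t. f (i, cis t)) \<theta> e" for i \<theta> e
    by (simp add: f_def node_const)
  ultimately have "coloring D f" by (simp add: coloring_def)
  moreover have "\<not> f constant_on strand_pts D"
  proof
    assume "f constant_on strand_pts D"
    then obtain y where y: "\<forall>p\<in>strand_pts D. f p = y" by (auto simp: constant_on_def)
    obtain i j where ij: "i \<in> A" "j \<in> B" using AB by blast
    then have "i \<in> A \<union> B" "j \<in> A \<union> B" "j \<notin> A" using AB(3) by blast+
    then have "i < ncomp D" "j < ncomp D" "j \<notin> A" unfolding AB(4) by simp_all
    then have "(i, cis 0) \<in> strand_pts D" "(j, cis 0) \<in> strand_pts D" by (simp_all add: strand_pts_def)
    then have "f (i, cis 0) = y" "f (j, cis 0) = y" using y by blast+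
    then show False using ij \<open>j \<notin> A\<close> by (simp add: f_def)
  qed
  ultimately show ?thesis by (auto simp: colorable_def)
qed

section \<open>Diagrams inside and outside the disk of a local move\<close>

lemma strand_arc:
  fixes \<alpha> :: "real \<Rightarrow> nat \<times> complex"
  assumes cont: "continuous_on {-1..1} \<alpha>" and inj: "inj_on \<alpha> {-1..1}"
    and sub: "\<alpha> ` {-1..1} \<subseteq> strand_pts D"
  shows "\<exists>c \<gamma>. continuous_on {-1..1} \<gamma> \<and> inj_on \<gamma> {-1..1} \<and> \<gamma> ` {-1..1} \<subseteq> sphere 0 1 \<and>
    (\<forall>s\<in>{-1..1}. \<alpha> s = (c, \<gamma> s))"
proof -
  \<comment> \<open>The number of the component is a continuous function into a discrete space, so
    it cannot change along the arc.\<close>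
  have "(fst \<circ> \<alpha>) constant_on {-1..1}"
  proof (rule locally_constant_imp_constant)
    fix a :: real assume a: "a \<in> {-1..1}"
    have "continuous_on {-1..1} (fst \<circ> \<alpha>)"
      unfolding o_def using cont by (rule continuous_on_fst)
    then have "openin (top_of_set {-1..1}) ({-1..1} \<inter> (fst \<circ> \<alpha>) -` {fst (\<alpha> a)})"
      by (rule continuous_openin_preimage_gen) (rule open_discrete)
    then show "\<exists>T. openin (top_of_set {-1..1}) T \<and> a \<in> T \<and> (\<forall>x\<in>T. (fst \<circ> \<alpha>) x = (fst \<circ> \<alpha>) a)"
      using a by (intro exI[of _ "{-1..1} \<inter> (fst \<circ> \<alpha>) -` {fst (\<alpha> a)}"]) simp
  qed simp
  then obtain c where c: "\<forall>s\<in>{-1..1}. fst (\<alpha> s) = c" by (auto simp: constant_on_def)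
  have eq: "\<forall>s\<in>{-1..1}. \<alpha> s = (c, (snd \<circ> \<alpha>) s)"
    using c by (auto simp: prod_eq_iff)
  moreover have "continuous_on {-1..1} (snd \<circ> \<alpha>)"
    unfolding o_def using cont by (rule continuous_on_snd)
  moreover have "inj_on (snd \<circ> \<alpha>) {-1..1}"
  proof (rule inj_onI)
    fix x y assume xy: "x \<in> {-1..1}" "y \<in> {-1..1}" "(snd \<circ> \<alpha>) x = (snd \<circ> \<alpha>) y"
    then have "\<alpha> x = \<alpha> y" using bspec[OF eq xy(1)] bspec[OF eq xy(2)] by metis
    then show "x = y" using inj xy by (simp add: inj_on_def)
  qed
  moreover have "(snd \<circ> \<alpha>) ` {-1..1} \<subseteq> sphere 0 1"
    using sub by (auto simp: strand_pts_def image_subset_iff)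
  ultimately show ?thesis by (intro exI[of _ c] exI[of _ "snd \<circ> \<alpha>"] conjI)
qed

lemma node_strand_arc:
  fixes \<alpha> :: "real \<Rightarrow> nat \<times> complex"
  assumes "continuous_on {-1..1} \<alpha>" "inj_on \<alpha> {-1..1}" "\<alpha> ` {-1..1} \<subseteq> strand_pts D"
    and s: "s \<in> {-1<..<1}" "\<alpha> s = (i, cis \<theta>)"
  shows "node (\<lambda>t. f (\<alpha> t)) s e \<longleftrightarrow> node (\<lambda>t. f (i, cis t)) \<theta> e"
proof -
  obtain c \<gamma> where \<gamma>: "continuous_on {-1..1} \<gamma>" "inj_on \<gamma> {-1..1}" "\<gamma> ` {-1..1} \<subseteq> sphere 0 1"
    and eq: "\<forall>s\<in>{-1..1}. \<alpha> s = (c, \<gamma> s)"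
    using strand_arc[OF assms(1-3)] by (elim exE conjE)
  have si: "c = i" "\<gamma> s = cis \<theta>" using bspec[OF eq, of s] s by simp_all
  have "node (\<lambda>t. f (\<alpha> t)) s e \<longleftrightarrow> node (\<lambda>t. f (c, \<gamma> t)) s e"
  proof
    assume "node (\<lambda>t. f (\<alpha> t)) s e"
    then show "node (\<lambda>t. f (c, \<gamma> t)) s e"
      by (rule node_cong_open[where S="{-1<..<1}"]) (use s eq in auto)
  next
    assume "node (\<lambda>t. f (c, \<gamma> t)) s e"
    then show "node (\<lambda>t. f (\<alpha> t)) s e"
      by (rule node_cong_open[where S="{-1<..<1}"]) (use s eq in auto)
  qed
  also have "\<dots> \<longleftrightarrow> node (\<lambda>t. f (c, cis t)) \<theta> e"
    using node_arc[OF \<gamma> s(1) si(2), of "\<lambda>z. f (c, z)"] .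
  finally show ?thesis using si by simp
qed

section \<open>Invariance under the moves\<close>

text \<open>Strand \<open>j\<close> of the disk of a local move at parameter \<open>s\<close> is encoded as \<open>(j, s)\<close>; \<open>tangle_rel\<close>
  is the analogue of \<open>crossing_rel\<close> in these parameters.\<close>

definition tangle_rel ::
  "nat \<Rightarrow> (nat \<Rightarrow> real \<Rightarrow> complex) \<Rightarrow> (nat \<times> real) set \<Rightarrow> ((nat \<times> real) \<times> (nat \<times> real)) set" where
  "tangle_rel m f F = {(x, y). x \<in> {..<m} \<times> {-1..1} \<and> y \<in> {..<m} \<times> {-1..1} \<and> x \<in> F \<and> y \<noteq> x \<and>
     f (fst y) (snd y) = f (fst x) (snd x)}"

text \<open>The local condition is required only on the open interval: at an end of the arc it would
  involve parameters beyond the disk.\<close>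

definition tangle_coloring ::
  "nat \<Rightarrow> ((nat \<times> real) \<times> (nat \<times> real)) set \<Rightarrow> (nat \<times> real \<Rightarrow> real) \<Rightarrow> bool" where
  "tangle_coloring m Y \<phi> \<longleftrightarrow>
     (\<forall>j<m. \<forall>s\<in>{-1<..<1}. node (\<lambda>t. \<phi> (j, t)) s ((j, s) \<in> snd ` Y)) \<and>
     (\<forall>x y. (x, y) \<in> Y \<longrightarrow> \<phi> y = \<phi> x)"

text \<open>Colorings of the first tangle can be changed to colorings of the second one without changing
  them near the boundary of the disk, and those constant near the boundary are constant. The second
  clause ensures that nonconstant colorings remain nonconstant.\<close>

definition tangle_sim ::
  "nat \<Rightarrow> real \<Rightarrow> ((nat \<times> real) \<times> (nat \<times> real)) set \<Rightarrow> ((nat \<times> real) \<times> (nat \<times> real)) set \<Rightarrow> bool" where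
  "tangle_sim m d Y Y' \<longleftrightarrow> (\<forall>\<phi>. tangle_coloring m Y \<phi> \<longrightarrow>
     (\<exists>\<psi>. tangle_coloring m Y' \<psi> \<and>
        (\<forall>j<m. \<forall>s. d < \<bar>s\<bar> \<and> \<bar>s\<bar> < 1 \<longrightarrow> \<psi> (j, s) = \<phi> (j, s))) \<and>
     (\<forall>c. (\<forall>j<m. \<forall>s. d < \<bar>s\<bar> \<and> \<bar>s\<bar> < 1 \<longrightarrow> \<phi> (j, s) = c) \<longrightarrow>
        (\<forall>j<m. \<forall>s. \<bar>s\<bar> < 1 \<longrightarrow> \<phi> (j, s) = c)))"

text \<open>Both the chart \<open>h\<close> and the parametrization \<open>A\<close> of the arcs are
  injective, so coincidences of points over the disk can be tested on the model curves.\<close>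

lemma crossing_rel_tangle:
  assumes inj: "inj_on A ({..<m} \<times> {-1..1})" "inj_on h square"
    and sub: "A ` ({..<m} \<times> {-1..1}) \<subseteq> strand_pts D"
    and sq: "\<And>j s. j < m \<Longrightarrow> s \<in> {-1..1} \<Longrightarrow> f j s \<in> square"
    and A: "\<And>j s. j < m \<Longrightarrow> s \<in> {-1..1} \<Longrightarrow> pos D (A (j, s)) = h (f j s) \<and> (A (j, s) \<in> over D \<longleftrightarrow> (j, s) \<in> F)"
    and xy: "x \<in> {..<m} \<times> {-1..1}" "y \<in> {..<m} \<times> {-1..1}"
  shows "(A x, A y) \<in> crossing_rel D \<longleftrightarrow> (x, y) \<in> tangle_rel m f F"
proof -
  obtain j s k t where x: "x = (j, s)" "j < m" "s \<in> {-1..1}" and y: "y = (k, t)" "k < m" "t \<in> {-1..1}"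
    using xy by auto
  have "pos D (A y) = pos D (A x) \<longleftrightarrow> f k t = f j s"
    using A[OF x(2,3)] A[OF y(2,3)] inj_on_eq_iff[OF inj(2) sq[OF y(2,3)] sq[OF x(2,3)]] x(1) y(1) by simp
  moreover have "A y \<noteq> A x \<longleftrightarrow> y \<noteq> x" using inj_on_eq_iff[OF inj(1) xy(2,1)] by simp
  moreover have "A x \<in> over D \<longleftrightarrow> x \<in> F" using A[OF x(2,3)] x(1) by simp
  moreover have "A y \<in> strand_pts D" using sub xy by blast
  ultimately show ?thesis
    unfolding crossing_rel_def tangle_rel_def using xy x(1) y(1) by simp
qed

lemma local_move_sym: "local_move m f F g G D E \<Longrightarrow> local_move m g G f F E D"
  unfolding local_move_def
  apply (elim exE conjE)
  subgoal for h \<alpha> W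
    by (intro conjI exI[of _ h] exI[of _ \<alpha>] exI[of _ W]) (auto simp: strand_pts_def)
  done

text \<open>The coloring of \<open>D\<close> is read in the disk, exchanged for the one that
  \<open>tangle_sim\<close> provides, and kept elsewhere. The pieces fit because they agree beyond
  the radius \<open>d\<close>: every point of the circles is either an inner point of an arc of the
  disk or has a neighborhood on which the old coloring is unchanged.\<close>

lemma local_move_colorable:
  assumes vd: "virtual_diagram D" "virtual_diagram E" and lm: "local_move m f F g G D E"
    and sq: "\<And>j s. j < m \<Longrightarrow> s \<in> {-1..1} \<Longrightarrow> f j s \<in> square"
      "\<And>j s. j < m \<Longrightarrow> s \<in> {-1..1} \<Longrightarrow> g j s \<in> square"
    and d: "d < 1"
      "\<And>x y. (x, y) \<in> tangle_rel m f F \<union> tangle_rel m g G \<Longrightarrow> \<bar>snd x\<bar> \<le> d \<and> \<bar>snd y\<bar> \<le> d"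
    and sim: "tangle_sim m d (tangle_rel m f F) (tangle_rel m g G)"
    and col: "colorable D"
  shows "colorable E"
proof -
  have nc: "ncomp E = ncomp D" using lm by (simp add: local_move_def)
  then have SE: "strand_pts E = strand_pts D" by (simp add: strand_pts_def)
  obtain h \<alpha> W where h: "inj_on h square" and \<alpha>: "\<forall>j<m. continuous_on {-1..1} (\<alpha> j)"
    and inj: "inj_on (\<lambda>(j, s). \<alpha> j s) ({..<m} \<times> {-1..1})"
    and W: "W = (\<lambda>(j, s). \<alpha> j s) ` ({..<m} \<times> {-1..1})"
    and WD: "{p\<in>strand_pts D. pos D p \<in> h ` square} = W"
    and WE: "{p\<in>strand_pts E. pos E p \<in> h ` square} = W"
    and off: "\<forall>p\<in>strand_pts D - W. pos E p = pos D p \<and> (p \<in> over E \<longleftrightarrow> p \<in> over D)"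
    and on: "\<forall>j<m. \<forall>s\<in>{-1..1}.
           pos D (\<alpha> j s) = h (f j s) \<and> (\<alpha> j s \<in> over D \<longleftrightarrow> (j, s) \<in> F) \<and>
           pos E (\<alpha> j s) = h (g j s) \<and> (\<alpha> j s \<in> over E \<longleftrightarrow> (j, s) \<in> G)"
    using lm unfolding local_move_def by (elim exE conjE)
  define A where "A = (\<lambda>(j, s). \<alpha> j s)"
  define P :: "(nat \<times> real) set" where "P = {..<m} \<times> {-1..1}"
  define Y where "Y = tangle_rel m f F"
  define Y' where "Y' = tangle_rel m g G"
  have injA: "inj_on A P" using inj by (simp add: A_def P_def)
  have WA: "W = A ` P" using W by (simp add: A_def P_def)
  have WS: "W \<subseteq> strand_pts D" using WD by blast
  have relD: "(A x, A y) \<in> crossing_rel D \<longleftrightarrow> (x, y) \<in> Y" if "x \<in> P" "y \<in> P" for x y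
    unfolding Y_def by (rule crossing_rel_tangle[where h=h])
      (use injA h WS WA sq on that in \<open>auto simp: A_def P_def\<close>)
  have relE: "(A x, A y) \<in> crossing_rel E \<longleftrightarrow> (x, y) \<in> Y'" if "x \<in> P" "y \<in> P" for x y
    unfolding Y'_def by (rule crossing_rel_tangle[where h=h])
      (use injA h WS WA sq on that SE in \<open>auto simp: A_def P_def\<close>)
  have YP: "x \<in> P \<and> y \<in> P \<and> \<bar>snd x\<bar> \<le> d \<and> \<bar>snd y\<bar> \<le> d" if "(x, y) \<in> Y \<union> Y'" for x y
    using d(2)[of x y] that by (auto simp: Y_def Y'_def tangle_rel_def P_def)
  \<comment> \<open>In either diagram \<open>W\<close> is the full preimage of the disk, so a
    crossing has both of its points in \<open>W\<close> or neither.\<close>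
  have satD: "p \<in> W \<longleftrightarrow> q \<in> W" if "(p, q) \<in> crossing_rel D" for p q
    using crossing_relD[OF vd(1) that] unfolding WD[symmetric] by simp
  have satE: "p \<in> W \<longleftrightarrow> q \<in> W" if "(p, q) \<in> crossing_rel E" for p q
    using crossing_relD[OF vd(2) that] unfolding WE[symmetric] by simp
  have outside: "(p, q) \<in> crossing_rel D \<longleftrightarrow> (p, q) \<in> crossing_rel E"
    if "p \<in> strand_pts D - W" "q \<in> strand_pts D - W" for p q
    using bspec[OF off that(1)] bspec[OF off that(2)] by (simp add: crossing_rel_def SE)
  have cA: "continuous_on {-1..1} (\<lambda>s. A (j, s))" "inj_on (\<lambda>s. A (j, s)) {-1..1}"
      "(\<lambda>s. A (j, s)) ` {-1..1} \<subseteq> strand_pts D" if "j < m" for j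
  proof -
    show "continuous_on {-1..1} (\<lambda>s. A (j, s))" using \<alpha> that by (simp add: A_def)
    show "inj_on (\<lambda>s. A (j, s)) {-1..1}"
      using injA that by (auto simp: inj_on_def P_def)
    show "(\<lambda>s. A (j, s)) ` {-1..1} \<subseteq> strand_pts D" using WS WA that by (auto simp: P_def)
  qed
  obtain f0 where f0: "coloring D f0" and ncst: "\<not> f0 constant_on strand_pts D"
    using col unfolding colorable_def by (elim exE conjE)
  have node0: "node (\<lambda>t. f0 (i, cis t)) \<theta> ((i, cis \<theta>) \<in> snd ` crossing_rel D)" if "i < ncomp D" for i \<theta>
    using f0 that by (simp add: coloring_def)
  define \<phi> where "\<phi> = (\<lambda>x. f0 (A x))"
  have "tangle_coloring m Y \<phi>"
    unfolding tangle_coloring_def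
  proof (intro conjI allI impI ballI)
    fix j s assume js: "j < m" "s \<in> {-1<..<(1::real)}"
    then have P: "(j, s) \<in> P" by (simp add: P_def)
    then have "A (j, s) \<in> strand_pts D" using WS WA by blast
    then obtain i \<theta> where i: "i < ncomp D" "A (j, s) = (i, cis \<theta>)" by (rule strand_ptsE)
    have "node (\<lambda>t. f0 (A (j, t))) s ((i, cis \<theta>) \<in> snd ` crossing_rel D)"
      using node_strand_arc[OF cA[OF js(1)] js(2) i(2), of f0] node0[OF i(1)] by simp
    then have "node (\<lambda>t. \<phi> (j, t)) s ((i, cis \<theta>) \<in> snd ` crossing_rel D)"
      by (simp add: \<phi>_def)
    then show "node (\<lambda>t. \<phi> (j, t)) s ((j, s) \<in> snd ` Y)"
    proof (rule node_mono)
      assume "(i, cis \<theta>) \<in> snd ` crossing_rel D"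
      then obtain p where p: "(p, A (j, s)) \<in> crossing_rel D" unfolding i(2) by auto
      moreover have "A (j, s) \<in> W" using P WA by blast
      ultimately have "p \<in> W" using satD by blast
      then obtain x where "x \<in> P" "p = A x" unfolding WA by blast
      then have "(x, (j, s)) \<in> Y" using p relD P by blast
      then show "(j, s) \<in> snd ` Y" by (rule image_eqI[rotated]) simp
    qed
  next
    fix x y assume xy: "(x, y) \<in> Y"
    then have "x \<in> P" "y \<in> P" using YP by blast+
    then have "(A x, A y) \<in> crossing_rel D" using relD xy by blast
    then show "\<phi> y = \<phi> x" unfolding \<phi>_def by (rule coloring_crossing[OF f0])
  qed
  then obtain \<psi> where \<psi>: "tangle_coloring m Y' \<psi>"
      and \<psi>\<phi>: "\<forall>j<m. \<forall>s. d < \<bar>s\<bar> \<and> \<bar>s\<bar> < 1 \<longrightarrow> \<psi> (j, s) = \<phi> (j, s)"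
      and cst: "\<forall>c. (\<forall>j<m. \<forall>s. d < \<bar>s\<bar> \<and> \<bar>s\<bar> < 1 \<longrightarrow> \<phi> (j, s) = c) \<longrightarrow>
        (\<forall>j<m. \<forall>s. \<bar>s\<bar> < 1 \<longrightarrow> \<phi> (j, s) = c)"
    using sim unfolding tangle_sim_def Y_def[symmetric] Y'_def[symmetric] by blast
  define Q :: "(nat \<times> real) set" where "Q = {..<m} \<times> {-1<..<1}"
  define f1 where "f1 = (\<lambda>p. if p \<in> A ` Q then \<psi> (inv_into P A p) else f0 p)"
  have QP: "Q \<subseteq> P" by (auto simp: Q_def P_def)
  have f1A: "f1 (A x) = \<psi> x" if "x \<in> Q" for x
    using that QP inv_into_f_f[OF injA, of x] by (auto simp: f1_def)
  \<comment> \<open>The new coloring differs from the old one at most on \<open>K\<close>. Since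
    \<open>K\<close> is closed, the old local condition carries over to all points outside
    it.\<close>
  define K where "K = A ` ({..<m} \<times> {-d..d})"
  have KQ: "{..<m} \<times> {-d..d} \<subseteq> Q" using d(1) by (auto simp: Q_def)
  have f1K: "f1 p = f0 p" if "p \<notin> K" for p
  proof (cases "p \<in> A ` Q")
    case True
    then obtain j s where js: "p = A (j, s)" "(j, s) \<in> Q" by auto
    have "\<not> \<bar>s\<bar> \<le> d"
    proof
      assume "\<bar>s\<bar> \<le> d"
      then have "(j, s) \<in> {..<m} \<times> {-d..d}" using js(2) by (auto simp: Q_def)
      then show False using that js(1) unfolding K_def by blast
    qed
    then have "\<psi> (j, s) = \<phi> (j, s)" using \<psi>\<phi> js(2) by (auto simp: Q_def)
    then show ?thesis using f1A[OF js(2)] js(1) by (simp add: \<phi>_def)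
  next
    case False
    then show ?thesis by (simp add: f1_def)
  qed
  have "closed K"
  proof -
    have "K = (\<Union>j\<in>{..<m}. (\<lambda>s. A (j, s)) ` {-d..d})" by (auto simp: K_def)
    moreover have "compact ((\<lambda>s. A (j, s)) ` {-d..d})" if "j < m" for j
    proof (rule compact_continuous_image)
      show "continuous_on {-d..d} (\<lambda>s. A (j, s))"
        using cA(1)[OF that] by (rule continuous_on_subset) (use d(1) in auto)
    qed simp
    ultimately show ?thesis by (auto intro!: closed_UN compact_imp_closed)
  qed
  have f1node: "node (\<lambda>t. f1 (i, cis t)) \<theta> ((i, cis \<theta>) \<in> snd ` crossing_rel E)"
    if i: "i < ncomp D" for i \<theta>
  proof (cases "(i, cis \<theta>) \<in> A ` Q")
    case True
    then obtain j s where js: "(i, cis \<theta>) = A (j, s)" "(j, s) \<in> Q" by auto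
    then have j: "j < m" "s \<in> {-1<..<1}" by (auto simp: Q_def)
    have "node (\<lambda>t. \<psi> (j, t)) s ((j, s) \<in> snd ` Y')"
      using \<psi> j by (simp add: tangle_coloring_def)
    then have "node (\<lambda>t. f1 (A (j, t))) s ((j, s) \<in> snd ` Y')"
      by (rule node_cong_open[where S="{-1<..<1}"]) (use j f1A in \<open>auto simp: Q_def\<close>)
    then have "node (\<lambda>t. f1 (i, cis t)) \<theta> ((j, s) \<in> snd ` Y')"
      using node_strand_arc[OF cA[OF j(1)] j(2) js(1)[symmetric], of f1] by simp
    then show ?thesis
    proof (rule node_mono)
      assume "(j, s) \<in> snd ` Y'"
      then obtain x where x: "(x, (j, s)) \<in> Y'" by auto
      then have "x \<in> P" using YP by blast
      then have "(A x, A (j, s)) \<in> crossing_rel E" using relE x js(2) QP by blast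
      then show "(i, cis \<theta>) \<in> snd ` crossing_rel E"
        unfolding js(1) by (rule image_eqI[rotated]) simp
    qed
  next
    case False
    then have nK: "(i, cis \<theta>) \<notin> K" using KQ by (auto simp: K_def)
    have "open ((\<lambda>t. (i, cis t)) -` (- K))"
      using \<open>closed K\<close> by (intro open_vimage continuous_intros) auto
    from node_cong_open[OF node0[OF i, of \<theta>] this, of "\<lambda>t. f1 (i, cis t)"] nK
    have "node (\<lambda>t. f1 (i, cis t)) \<theta> ((i, cis \<theta>) \<in> snd ` crossing_rel D)"
      using f1K by simp
    then show ?thesis
    proof (rule node_mono)
      assume "(i, cis \<theta>) \<in> snd ` crossing_rel D"
      then obtain p where p: "(p, (i, cis \<theta>)) \<in> crossing_rel D" by auto
      \<comment> \<open>Not being in the image of \<open>Q\<close>, a point of \<open>W\<close>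
        would have to be an end of an arc; but crossings in the disk have parameters of absolute
        value at most \<open>d < 1\<close>.\<close>
      have "(i, cis \<theta>) \<notin> W"
      proof
        assume q: "(i, cis \<theta>) \<in> W"
        then have "p \<in> W" using satD p by blast
        then obtain x y where x: "x \<in> P" "p = A x" and y: "y \<in> P" "(i, cis \<theta>) = A y"
          using q unfolding WA by blast
        then have "(x, y) \<in> Y" using p relD by simp
        then have "\<bar>snd y\<bar> \<le> d" using YP by blast
        then have "y \<in> Q" using y(1) d(1) by (auto simp: Q_def P_def)
        then show False using False y(2) by simp
      qed
      then have "p \<notin> W" using satD p by blast
      have "(p, (i, cis \<theta>)) \<in> crossing_rel E"
        using outside[of p "(i, cis \<theta>)"] p \<open>p \<notin> W\<close> \<open>(i, cis \<theta>) \<notin> W\<close> crossing_relD(1,2)[OF vd(1) p]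
        by simp
      then show "(i, cis \<theta>) \<in> snd ` crossing_rel E" by (rule image_eqI[rotated]) simp
    qed
  qed
  have f1cross: "f1 q = f1 p" if pq: "(p, q) \<in> crossing_rel E" for p q
  proof (cases "p \<in> W")
    case True
    then have "q \<in> W" using satE[OF pq] by blast
    then obtain x y where x: "x \<in> P" "p = A x" and y: "y \<in> P" "q = A y"
      using True unfolding WA by blast
    then have Y: "(x, y) \<in> Y'" using pq relE by simp
    then have "\<bar>snd x\<bar> \<le> d" "\<bar>snd y\<bar> \<le> d" using YP by blast+
    then have "x \<in> Q" "y \<in> Q" using x(1) y(1) d(1) by (auto simp: Q_def P_def)
    moreover have "\<psi> y = \<psi> x" using \<psi> Y unfolding tangle_coloring_def by blast
    ultimately show ?thesis using f1A x(2) y(2) by simp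
  next
    case False
    then have "q \<notin> W" using satE[OF pq] by blast
    have "(p, q) \<in> crossing_rel D"
      using outside[of p q] pq False \<open>q \<notin> W\<close> crossing_relD(1,2)[OF vd(2) pq] SE by simp
    then have "f0 q = f0 p" by (rule coloring_crossing[OF f0])
    moreover have "K \<subseteq> W" using KQ QP WA by (auto simp: K_def)
    ultimately show ?thesis using f1K False \<open>q \<notin> W\<close> by (metis subsetD)
  qed
  have "coloring E f1"
    unfolding coloring_def nc using f1node f1cross by simp
  moreover have "\<not> f1 constant_on strand_pts E"
  proof
    assume "f1 constant_on strand_pts E"
    then obtain c where c: "\<forall>p\<in>strand_pts D. f1 p = c" unfolding constant_on_def SE by (elim exE)
    \<comment> \<open>If the new coloring is constant, the old one is constant near the boundary of
      the disk, hence inside it by the second clause of \<open>tangle_sim\<close>, and so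
      everywhere.\<close>
    have "\<phi> (j, s) = c" if "j < m" "d < \<bar>s\<bar> \<and> \<bar>s\<bar> < 1" for j s
    proof -
      have Q: "(j, s) \<in> Q" using that by (auto simp: Q_def)
      then have "A (j, s) \<in> strand_pts D" using QP WA WS by blast
      then have "\<psi> (j, s) = c" using f1A[OF Q] c by simp
      then show ?thesis using \<psi>\<phi> that by simp
    qed
    then have \<phi>c: "\<forall>j<m. \<forall>s. \<bar>s\<bar> < 1 \<longrightarrow> \<phi> (j, s) = c"
      using cst by blast
    have "f0 p = c" if p: "p \<in> strand_pts D" for p
    proof (cases "p \<in> K")
      case True
      then obtain j s where "p = A (j, s)" "(j, s) \<in> Q" using KQ by (auto simp: K_def)
      then show ?thesis using \<phi>c by (auto simp: \<phi>_def Q_def)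
    next
      case False
      then show ?thesis using f1K[of p] bspec[OF c p] by simp
    qed
    then have "f0 constant_on strand_pts D" unfolding constant_on_def by (intro exI ballI)
    then show False using ncst by blast
  qed
  ultimately show ?thesis unfolding colorable_def by (intro exI conjI)
qed

section \<open>Colorings of the tangles of the Reidemeister moves\<close>

lemma node_step1: "node (\<lambda>t. k + a * sgn (t - x)) s (s = x)"
  by (rule node_mono[OF node_add[OF node_const[where b=False] node_scale_sgn]]) simp

lemma node_step2: "node (\<lambda>t. k + a * sgn (t - x) + b * sgn (t - y)) s (s = x \<or> s = y)"
  by (rule node_add[OF node_step1 node_scale_sgn])

text \<open>Beyond the radius \<open>d\<close> all jumps have been passed, so a step function shows
  there only its constant and the sum of its jump coefficients. Two colorings match near the
  boundary of the disk as soon as these two numbers agree on every strand.\<close>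

lemma sgn_diff_far:
  fixes s x d :: real
  assumes "d < \<bar>s\<bar>" "\<bar>x\<bar> \<le> d" shows "sgn (s - x) = sgn s"
  using assms by (auto simp: sgn_if)

text \<open>Since \<open>sgn 0 = 0\<close>, the functions \<open>sgn (s - x)\<close> have the mean value at their jump.\<close>

lemma tangle_strand:
  assumes "tangle_coloring m Y \<phi>" "j < m" "finite S" "S \<subseteq> {-1<..<1}"
    and "\<And>s. (j, s) \<in> snd ` Y \<Longrightarrow> s \<in> S"
  shows "\<exists>k c. \<forall>s\<in>{-1<..<1}. \<phi> (j, s) = k + (\<Sum>x\<in>S. c x * sgn (s - x))"
proof (rule node_step_function[OF assms(3,4)])
  fix s :: real assume s: "s \<in> {-1<..<1}"
  then have "node (\<lambda>t. \<phi> (j, t)) s ((j, s) \<in> snd ` Y)"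
    using assms(1,2) by (simp add: tangle_coloring_def)
  then show "node (\<lambda>t. \<phi> (j, t)) s (s \<in> S)"
    by (rule node_mono) (rule assms(5))
qed

lemma tangle_strand0:
  assumes "tangle_coloring m Y \<phi>" "j < m" "\<And>s. (j, s) \<notin> snd ` Y"
  shows "\<exists>k. \<forall>s\<in>{-1<..<1}. \<phi> (j, s) = k"
  using tangle_strand[OF assms(1,2), of "{}"] assms(3) by auto

lemma tangle_strand1:
  assumes "tangle_coloring m Y \<phi>" "j < m" "\<And>s. (j, s) \<in> snd ` Y \<Longrightarrow> s = x" "x \<in> {-1<..<1}"
  shows "\<exists>k a. \<forall>s\<in>{-1<..<1}. \<phi> (j, s) = k + a * sgn (s - x)"
proof -
  obtain k c where "\<forall>s\<in>{-1<..<1}. \<phi> (j, s) = k + (\<Sum>x\<in>{x}. c x * sgn (s - x))"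
    using tangle_strand[OF assms(1,2), of "{x}"] assms(3,4) by auto
  then show ?thesis by (intro exI[of _ k] exI[of _ "c x"]) simp
qed

lemma tangle_strand2:
  assumes "tangle_coloring m Y \<phi>" "j < m" "\<And>s. (j, s) \<in> snd ` Y \<Longrightarrow> s = x \<or> s = y"
    "x \<in> {-1<..<1}" "y \<in> {-1<..<1}" "x \<noteq> y"
  shows "\<exists>k a b. \<forall>s\<in>{-1<..<1}. \<phi> (j, s) = k + a * sgn (s - x) + b * sgn (s - y)"
proof -
  obtain k c where "\<forall>s\<in>{-1<..<1}. \<phi> (j, s) = k + (\<Sum>x\<in>{x, y}. c x * sgn (s - x))"
    using tangle_strand[OF assms(1,2), of "{x, y}"] assms(3-5) by auto
  then show ?thesis using assms(6)
    by (intro exI[of _ k] exI[of _ "c x"] exI[of _ "c y"]) (simp add: add.assoc)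
qed

lemma tangle_simI:
  assumes "\<And>\<phi>. tangle_coloring m Y \<phi> \<Longrightarrow>
     \<exists>\<psi>. tangle_coloring m Y' \<psi> \<and>
        (\<forall>j<m. \<forall>s. d < \<bar>s\<bar> \<and> \<bar>s\<bar> < 1 \<longrightarrow> \<psi> (j, s) = \<phi> (j, s))"
    and "\<And>\<phi> c. \<lbrakk>tangle_coloring m Y \<phi>; \<forall>j<m. \<forall>s. d < \<bar>s\<bar> \<and> \<bar>s\<bar> < 1 \<longrightarrow> \<phi> (j, s) = c\<rbrakk> \<Longrightarrow>
        \<forall>j<m. \<forall>s. \<bar>s\<bar> < 1 \<longrightarrow> \<phi> (j, s) = c"
  shows "tangle_sim m d Y Y'"
  unfolding tangle_sim_def
proof (intro allI impI)
  fix \<phi> assume \<phi>: "tangle_coloring m Y \<phi>"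
  show "(\<exists>\<psi>. tangle_coloring m Y' \<psi> \<and>
        (\<forall>j<m. \<forall>s. d < \<bar>s\<bar> \<and> \<bar>s\<bar> < 1 \<longrightarrow> \<psi> (j, s) = \<phi> (j, s))) \<and>
     (\<forall>c. (\<forall>j<m. \<forall>s. d < \<bar>s\<bar> \<and> \<bar>s\<bar> < 1 \<longrightarrow> \<phi> (j, s) = c) \<longrightarrow>
        (\<forall>j<m. \<forall>s. \<bar>s\<bar> < 1 \<longrightarrow> \<phi> (j, s) = c))"
    by (rule conjI[OF assms(1)[OF \<phi>]]) (rule allI, rule impI, rule assms(2)[OF \<phi>])
qed

lemma tangle_coloring_const: "tangle_coloring m Y (\<lambda>_. k)"
  by (simp add: tangle_coloring_def node_const)

text \<open>The strand can jump only at the under parameter \<open>y\<close>, where it has the value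
  \<open>k\<close>; at the over parameter \<open>x\<close> it is \<open>k + a\<close> or
  \<open>k - a\<close>. The crossing equates the two, so \<open>a = 0\<close>. Hence all colorings
  are constant, and a constant colors every \<open>Y'\<close>. The empty \<open>Y\<close> serves the
  reverse move.\<close>

lemma R1_sim:
  assumes d: "\<bar>x\<bar> \<le> d" "\<bar>y\<bar> \<le> d" "d < 1" and "x \<noteq> y"
    and Y: "Y = {} \<or> Y = {((0, x), (0, y))}"
  shows "tangle_sim 1 d Y Y'"
proof -
  have *: "\<exists>k. \<forall>s\<in>{-1<..<1}. \<phi> (0, s) = k" if \<phi>: "tangle_coloring 1 Y \<phi>" for \<phi>
  proof -
    have "\<exists>k a. \<forall>s\<in>{-1<..<1}. \<phi> (0, s) = k + a * sgn (s - y)"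
      by (rule tangle_strand1[OF \<phi>]) (use Y d in auto)
    then obtain k a where ka: "\<forall>s\<in>{-1<..<1}. \<phi> (0, s) = k + a * sgn (s - y)"
      by (elim exE)
    from Y show ?thesis
    proof
      assume "Y = {}"
      then show ?thesis using tangle_strand0[OF \<phi>, of 0] by simp
    next
      assume "Y = {((0, x), (0, y))}"
      then have "\<phi> (0, y) = \<phi> (0, x)" using \<phi> by (simp add: tangle_coloring_def)
      moreover have "x \<in> {-1<..<1}" "y \<in> {-1<..<1}" using d by auto
      ultimately have "a * sgn (x - y) = 0" using ka by simp
      then have "a = 0" using \<open>x \<noteq> y\<close> by (simp add: sgn_if split: if_splits)
      then show ?thesis using ka by (intro exI[of _ k]) simp
    qed
  qed
  \<comment> \<open>The midpoint of \<open>d\<close> and 1 is a sample parameter near the boundary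
    of the disk, where the color is known to be \<open>c\<close>.\<close>
  have d0: "d < \<bar>(d + 1) / 2\<bar>" "\<bar>(d + 1) / 2\<bar> < 1" using d by auto
  show ?thesis
  proof (rule tangle_simI)
    fix \<phi> assume "tangle_coloring 1 Y \<phi>"
    from *[OF this] obtain k where k: "\<forall>s\<in>{-1<..<1}. \<phi> (0, s) = k" by (elim exE)
    have "\<forall>j<1. \<forall>s. d < \<bar>s\<bar> \<and> \<bar>s\<bar> < 1 \<longrightarrow> k = \<phi> (j, s)" using k by (auto simp: abs_if split: if_splits)
    then show "\<exists>\<psi>. tangle_coloring 1 Y' \<psi> \<and>
        (\<forall>j<1. \<forall>s. d < \<bar>s\<bar> \<and> \<bar>s\<bar> < 1 \<longrightarrow> \<psi> (j, s) = \<phi> (j, s))"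
      by (intro exI[of _ "\<lambda>_. k"] conjI tangle_coloring_const)
  next
    fix \<phi> c assume \<phi>: "tangle_coloring 1 Y \<phi>"
      and c: "\<forall>j<1. \<forall>s. d < \<bar>s\<bar> \<and> \<bar>s\<bar> < 1 \<longrightarrow> \<phi> (j, s) = c"
    from *[OF \<phi>] obtain k where k: "\<forall>s\<in>{-1<..<1}. \<phi> (0, s) = k" by (elim exE)
    have "\<phi> (0, (d + 1) / 2) = c" using c d0 by simp
    moreover have "\<phi> (0, (d + 1) / 2) = k" using bspec[OF k, of "(d + 1) / 2"] d0 by (simp add: abs_less_iff)
    ultimately show "\<forall>j<1. \<forall>s. \<bar>s\<bar> < 1 \<longrightarrow> \<phi> (j, s) = c"
      using k by (auto simp: abs_less_iff)
  qed
qed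

text \<open>The over strand \<open>m\<close> has a constant color \<open>a\<close>. The crossings at
  \<open>x\<close> and \<open>y\<close> give \<open>k - q = a\<close> and \<open>k + p = a\<close>
  for the jump coefficients \<open>p\<close>, \<open>q\<close> of strand \<open>n\<close>, so these
  are opposite: strand \<open>n\<close> has color \<open>k\<close> outside and
  \<open>2 * a - k\<close> between the crossings. Removing the crossings leaves the constant
  \<open>k\<close>.\<close>

lemma R2_sim_remove:
  assumes d: "\<bar>x\<bar> \<le> d" "\<bar>y\<bar> \<le> d" "d < 1" and "x < y"
    and mn: "{m, n} = {0, 1 :: nat}" "m \<noteq> n"
    and Y: "Y = {((m, x), (n, x)), ((m, y), (n, y))}"
  shows "tangle_sim 2 d Y {}"
proof -
  have lt: "m < 2" "n < 2" using mn by (auto simp: doubleton_eq_iff)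
  have cases2: "j = m \<or> j = n" if "j < 2" for j
    using mn that by (auto simp: doubleton_eq_iff less_2_cases_iff)
  have xy: "x \<in> {-1<..<1}" "y \<in> {-1<..<1}" using d by auto
  have *: "\<exists>a k. \<forall>s\<in>{-1<..<1}. \<phi> (m, s) = a \<and>
      \<phi> (n, s) = k + (a - k) * sgn (s - x) - (a - k) * sgn (s - y)" if \<phi>: "tangle_coloring 2 Y \<phi>" for \<phi>
  proof -
    have "\<exists>k. \<forall>s\<in>{-1<..<1}. \<phi> (m, s) = k"
      by (rule tangle_strand0[OF \<phi>]) (use Y mn lt in auto)
    then obtain a where a: "\<forall>s\<in>{-1<..<1}. \<phi> (m, s) = a" by (elim exE)
    have "\<exists>k p q. \<forall>s\<in>{-1<..<1}. \<phi> (n, s) = k + p * sgn (s - x) + q * sgn (s - y)"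
      by (rule tangle_strand2[OF \<phi>]) (use Y xy \<open>x < y\<close> lt in auto)
    then obtain k p q where k: "\<forall>s\<in>{-1<..<1}. \<phi> (n, s) = k + p * sgn (s - x) + q * sgn (s - y)"
      by (elim exE)
    have "\<phi> (n, x) = \<phi> (m, x)" "\<phi> (n, y) = \<phi> (m, y)"
      using \<phi> Y by (simp_all add: tangle_coloring_def)
    then have "k - q = a" "k + p = a"
      using a bspec[OF k xy(1)] bspec[OF k xy(2)] xy \<open>x < y\<close> by simp_all
    then have q: "q = - (a - k)" and p: "p = a - k" by auto
    have "\<forall>s\<in>{-1<..<1}. \<phi> (m, s) = a \<and> \<phi> (n, s) = k + (a - k) * sgn (s - x) - (a - k) * sgn (s - y)"
      using a k unfolding p q by (simp del: minus_diff_eq)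
    then show ?thesis by (intro exI)
  qed
  have d0: "d < \<bar>(d + 1) / 2\<bar>" "\<bar>(d + 1) / 2\<bar> < 1" using d by auto
  show ?thesis
  proof (rule tangle_simI)
    fix \<phi> assume "tangle_coloring 2 Y \<phi>"
    from *[OF this] obtain a k where ak: "\<forall>s\<in>{-1<..<1}. \<phi> (m, s) = a \<and>
      \<phi> (n, s) = k + (a - k) * sgn (s - x) - (a - k) * sgn (s - y)" by (elim exE)
    define \<psi> where "\<psi> = (\<lambda>(j, s :: real). if j = m then a else k)"
    have "tangle_coloring 2 {} \<psi>"
      unfolding tangle_coloring_def \<psi>_def by (simp add: node_const)
    moreover have "\<psi> (j, s) = \<phi> (j, s)" if "j < 2" "d < \<bar>s\<bar> \<and> \<bar>s\<bar> < 1" for j s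
    proof -
      have "s \<in> {-1<..<1}" using that by (auto simp: abs_less_iff)
      from bspec[OF ak this] show ?thesis
        using cases2[OF that(1)] mn(2) sgn_diff_far[of d s x] sgn_diff_far[of d s y] d that
        by (auto simp: \<psi>_def)
    qed
    ultimately show "\<exists>\<psi>. tangle_coloring 2 {} \<psi> \<and>
        (\<forall>j<2. \<forall>s. d < \<bar>s\<bar> \<and> \<bar>s\<bar> < 1 \<longrightarrow> \<psi> (j, s) = \<phi> (j, s))"
      by (intro exI[of _ \<psi>]) simp
  next
    fix \<phi> c assume \<phi>: "tangle_coloring 2 Y \<phi>"
      and c: "\<forall>j<2. \<forall>s. d < \<bar>s\<bar> \<and> \<bar>s\<bar> < 1 \<longrightarrow> \<phi> (j, s) = c"
    from *[OF \<phi>] obtain a k where ak: "\<forall>s\<in>{-1<..<1}. \<phi> (m, s) = a \<and>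
      \<phi> (n, s) = k + (a - k) * sgn (s - x) - (a - k) * sgn (s - y)" by (elim exE)
    let ?s = "(d + 1) / 2"
    have "\<phi> (m, ?s) = c" "\<phi> (n, ?s) = c" using c d0 lt by simp_all
    moreover have "?s \<in> {-1<..<1}" using d0 by (simp add: abs_less_iff)
    from bspec[OF ak this] have "\<phi> (m, ?s) = a" "\<phi> (n, ?s) = k"
      using sgn_diff_far[OF d0(1) d(1)] sgn_diff_far[OF d0(1) d(2)] by simp_all
    ultimately have "a = c" "k = c" by simp_all
    show "\<forall>j<2. \<forall>s. \<bar>s\<bar> < 1 \<longrightarrow> \<phi> (j, s) = c"
    proof (intro allI impI)
      fix j s assume "j < (2 :: nat)" "\<bar>s\<bar> < (1 :: real)"
      then have "s \<in> {-1<..<1}" by (auto simp: abs_less_iff)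
      from bspec[OF ak this] show "\<phi> (j, s) = c"
        using cases2[OF \<open>j < 2\<close>] \<open>a = c\<close> \<open>k = c\<close> by auto
    qed
  qed
qed

lemma R2_sim_create:
  assumes d: "\<bar>x\<bar> \<le> d" "\<bar>y\<bar> \<le> d" "d < 1" and "x < y"
    and mn: "{m, n} = {0, 1 :: nat}" "m \<noteq> n"
    and Y: "Y = {((m, x), (n, x)), ((m, y), (n, y))}"
  shows "tangle_sim 2 d {} Y"
proof -
  have lt: "m < 2" "n < 2" using mn by (auto simp: doubleton_eq_iff)
  have cases2: "j = m \<or> j = n" if "j < 2" for j
    using mn that by (auto simp: doubleton_eq_iff less_2_cases_iff)
  have *: "\<exists>a k. \<forall>s\<in>{-1<..<1}. \<phi> (m, s) = a \<and> \<phi> (n, s) = k"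
    if \<phi>: "tangle_coloring 2 {} \<phi>" for \<phi>
  proof -
    obtain a where "\<forall>s\<in>{-1<..<1}. \<phi> (m, s) = a"
      using tangle_strand0[OF \<phi> lt(1)] by auto
    moreover obtain k where "\<forall>s\<in>{-1<..<1}. \<phi> (n, s) = k"
      using tangle_strand0[OF \<phi> lt(2)] by auto
    ultimately have "\<forall>s\<in>{-1<..<1}. \<phi> (m, s) = a \<and> \<phi> (n, s) = k" by simp
    then show ?thesis by (intro exI[of _ a] exI[of _ k]) simp
  qed
  have d0: "d < \<bar>(d + 1) / 2\<bar>" "\<bar>(d + 1) / 2\<bar> < 1" using d by auto
  show ?thesis
  proof (rule tangle_simI)
    fix \<phi> assume "tangle_coloring 2 {} \<phi>"
    from *[OF this] obtain a k where ak: "\<forall>s\<in>{-1<..<1}. \<phi> (m, s) = a \<and> \<phi> (n, s) = k"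
      by (elim exE)
    \<comment> \<open>These are the jumps forced in \<open>R2_sim_remove\<close>: the value is
      \<open>a\<close> at both crossings and \<open>k\<close> outside.\<close>
    define \<psi> where "\<psi> = (\<lambda>(j, s). if j = m then a else
      k + (a - k) * sgn (s - x) + (k - a) * sgn (s - y))"
    have "tangle_coloring 2 Y \<psi>"
      unfolding tangle_coloring_def
    proof (intro conjI allI impI ballI)
      fix j s assume "j < (2 :: nat)"
      from cases2[OF this] show "node (\<lambda>t. \<psi> (j, t)) s ((j, s) \<in> snd ` Y)"
      proof
        assume "j = m"
        then show ?thesis by (simp add: \<psi>_def node_const)
      next
        assume "j = n"
        then have "(\<lambda>t. \<psi> (j, t)) = (\<lambda>t. k + (a - k) * sgn (t - x) + (k - a) * sgn (t - y))"
          using mn(2) by (simp add: \<psi>_def)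
        moreover have "node (\<lambda>t. k + (a - k) * sgn (t - x) + (k - a) * sgn (t - y)) s ((j, s) \<in> snd ` Y)"
          by (rule node_mono[OF node_step2]) (use Y \<open>j = n\<close> in auto)
        ultimately show ?thesis by simp
      qed
    next
      fix p q assume "(p, q) \<in> Y"
      then show "\<psi> q = \<psi> p" using Y mn(2) \<open>x < y\<close> by (auto simp: \<psi>_def)
    qed
    moreover have "\<psi> (j, s) = \<phi> (j, s)" if "j < 2" "d < \<bar>s\<bar> \<and> \<bar>s\<bar> < 1" for j s
    proof -
      have "s \<in> {-1<..<1}" using that by (auto simp: abs_less_iff)
      from bspec[OF ak this] show ?thesis
        using cases2[OF that(1)] mn(2) sgn_diff_far[of d s x] sgn_diff_far[of d s y] d that
        by (auto simp: \<psi>_def algebra_simps)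
    qed
    ultimately show "\<exists>\<psi>. tangle_coloring 2 Y \<psi> \<and>
        (\<forall>j<2. \<forall>s. d < \<bar>s\<bar> \<and> \<bar>s\<bar> < 1 \<longrightarrow> \<psi> (j, s) = \<phi> (j, s))"
      by (intro exI[of _ \<psi>]) simp
  next
    fix \<phi> c assume \<phi>: "tangle_coloring 2 {} \<phi>"
      and c: "\<forall>j<2. \<forall>s. d < \<bar>s\<bar> \<and> \<bar>s\<bar> < 1 \<longrightarrow> \<phi> (j, s) = c"
    from *[OF \<phi>] obtain a k where ak: "\<forall>s\<in>{-1<..<1}. \<phi> (m, s) = a \<and> \<phi> (n, s) = k"
      by (elim exE)
    let ?s = "(d + 1) / 2"
    have "\<phi> (m, ?s) = c" "\<phi> (n, ?s) = c" using c d0 lt by simp_all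
    moreover have "?s \<in> {-1<..<1}" using d0 by (simp add: abs_less_iff)
    from bspec[OF ak this] have "\<phi> (m, ?s) = a" "\<phi> (n, ?s) = k" by simp_all
    ultimately have "a = c" "k = c" by simp_all
    show "\<forall>j<2. \<forall>s. \<bar>s\<bar> < 1 \<longrightarrow> \<phi> (j, s) = c"
    proof (intro allI impI)
      fix j s assume "j < (2 :: nat)" "\<bar>s\<bar> < (1 :: real)"
      then have "s \<in> {-1<..<1}" by (auto simp: abs_less_iff)
      from bspec[OF ak this] show "\<phi> (j, s) = c"
        using cases2[OF \<open>j < 2\<close>] \<open>a = c\<close> \<open>k = c\<close> by auto
    qed
  qed
qed

text \<open>Strand 0 passes over the other two, and strand 1 over strand 2. Moving strand 0 across
  the crossing at 0 changes the signs of its crossing parameters, which is all that matters about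
  them; the sign \<open>\<sigma>\<close> lets one argument serve both directions. The crossing at
  \<open>x\<^sub>1\<close> gives strands 0 and 1 the same constant \<open>a\<close>, and the other
  two crossings give the two linear relations between the coefficients.\<close>

lemma R3_sim:
  fixes x\<^sub>1 x\<^sub>2 y\<^sub>1 y\<^sub>2 \<sigma> d :: real
  assumes d: "\<bar>x\<^sub>1\<bar> \<le> d" "\<bar>x\<^sub>2\<bar> \<le> d" "\<bar>y\<^sub>1\<bar> \<le> d" "\<bar>y\<^sub>2\<bar> \<le> d" "d < 1"
    and \<sigma>: "\<sigma> \<noteq> 0" "sgn x\<^sub>1 = - \<sigma>" "sgn x\<^sub>2 = \<sigma>" "sgn y\<^sub>1 = \<sigma>" "sgn y\<^sub>2 = - \<sigma>"
    and Y: "Y = {((0, x\<^sub>1), (1, x\<^sub>1)), ((0, x\<^sub>2), (2, x\<^sub>2)), ((1, 0), (2, 0))}"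
    and Y': "Y' = {((0, y\<^sub>1), (1, y\<^sub>1)), ((0, y\<^sub>2), (2, y\<^sub>2)), ((1, 0), (2, 0))}"
  shows "tangle_sim 3 d Y Y'"
proof -
  have ins: "x\<^sub>1 \<in> {-1<..<1}" "x\<^sub>2 \<in> {-1<..<1}" "(0::real) \<in> {-1<..<1}" using d by auto
  have ne: "x\<^sub>2 \<noteq> 0" using \<sigma> by auto
  have cases3: "j = 0 \<or> j = 1 \<or> j = 2" if "j < 3" for j :: nat using that by auto
  have *: "\<exists>a c e p q. (\<forall>s\<in>{-1<..<1}. \<phi> (0, s) = a \<and> \<phi> (1, s) = a + c * sgn (s - x\<^sub>1) \<and>
      \<phi> (2, s) = e + p * sgn (s - x\<^sub>2) + q * sgn (s - 0)) \<and> e + q * \<sigma> = a \<and> p + q = - c"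
    if \<phi>: "tangle_coloring 3 Y \<phi>" for \<phi>
  proof -
    have "\<exists>k. \<forall>s\<in>{-1<..<1}. \<phi> (0, s) = k"
      by (rule tangle_strand0[OF \<phi>]) (use Y in auto)
    then obtain a where a: "\<forall>s\<in>{-1<..<1}. \<phi> (0, s) = a" by (elim exE)
    have "\<exists>k c. \<forall>s\<in>{-1<..<1}. \<phi> (1, s) = k + c * sgn (s - x\<^sub>1)"
      by (rule tangle_strand1[OF \<phi>]) (use Y ins in auto)
    then obtain k c where k: "\<forall>s\<in>{-1<..<1}. \<phi> (1, s) = k + c * sgn (s - x\<^sub>1)" by (elim exE)
    have "\<exists>e p q. \<forall>s\<in>{-1<..<1}. \<phi> (2, s) = e + p * sgn (s - x\<^sub>2) + q * sgn (s - 0)"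
      by (rule tangle_strand2[OF \<phi>]) (use Y ins ne in auto)
    then obtain e p q where e: "\<forall>s\<in>{-1<..<1}. \<phi> (2, s) = e + p * sgn (s - x\<^sub>2) + q * sgn (s - 0)"
      by (elim exE)
    have cr: "\<phi> (1, x\<^sub>1) = \<phi> (0, x\<^sub>1)" "\<phi> (2, x\<^sub>2) = \<phi> (0, x\<^sub>2)" "\<phi> (2, 0) = \<phi> (1, 0)"
      using \<phi> Y by (simp_all add: tangle_coloring_def)
    have 1: "k = a" using cr(1) bspec[OF a ins(1)] bspec[OF k ins(1)] by simp
    have 2: "e + q * \<sigma> = a" using cr(2) bspec[OF a ins(2)] bspec[OF e ins(2)] \<sigma>(3) by simp
    have "e + p * sgn (- x\<^sub>2) = k + c * sgn (- x\<^sub>1)"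
      using cr(3) bspec[OF k ins(3)] bspec[OF e ins(3)] by simp
    then have "e - p * \<sigma> = a + c * \<sigma>" using \<sigma>(2,3) 1 by (simp add: sgn_minus)
    then have "(p + q + c) * \<sigma> = 0" using 2 by (simp add: algebra_simps)
    then have "p + q = - c" using \<sigma>(1) by simp
    then show ?thesis using a k e 1 2
      by (intro exI[of _ a] exI[of _ c] exI[of _ e] exI[of _ p] exI[of _ q]) simp
  qed
  have d0: "d < \<bar>(d + 1) / 2\<bar>" "\<bar>(d + 1) / 2\<bar> < 1" using d by auto
  have d0': "0 \<le> d" using d by linarith
  show ?thesis
  proof (rule tangle_simI)
    fix \<phi> assume "tangle_coloring 3 Y \<phi>"
    from *[OF this] obtain a c e p q where \<phi>: "\<forall>s\<in>{-1<..<1}. \<phi> (0, s) = a \<and>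
        \<phi> (1, s) = a + c * sgn (s - x\<^sub>1) \<and> \<phi> (2, s) = e + p * sgn (s - x\<^sub>2) + q * sgn (s - 0)"
      and rel: "e + q * \<sigma> = a" "p + q = - c"
      by (elim exE conjE)
    \<comment> \<open>On strand 2 the value at \<open>y\<^sub>2\<close> must again be
      \<open>a\<close>. Since \<open>y\<^sub>2\<close> and \<open>x\<^sub>2\<close> lie on opposite
      sides of 0, this turns the coefficient \<open>q\<close> of the jump at 0 into
      \<open>- q\<close>. The coefficient \<open>q - c\<close> then keeps the sum equal to
      \<open>p + q = - c\<close>, so the outer colors do not change.\<close>
    define \<psi> where "\<psi> = (\<lambda>(j :: nat, s). if j = 0 then a else if j = 1 then a + c * sgn (s - y\<^sub>1)
      else e + (q - c) * sgn (s - y\<^sub>2) + (- q) * sgn (s - 0))"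
    have "tangle_coloring 3 Y' \<psi>"
      unfolding tangle_coloring_def
    proof (intro conjI allI impI ballI)
      fix j :: nat and s :: real assume "j < 3"
      from cases3[OF this] show "node (\<lambda>t. \<psi> (j, t)) s ((j, s) \<in> snd ` Y')"
      proof (elim disjE)
        assume "j = 0"
        then show ?thesis by (simp add: \<psi>_def node_const)
      next
        assume j: "j = 1"
        have "node (\<lambda>t. a + c * sgn (t - y\<^sub>1)) s ((j, s) \<in> snd ` Y')"
          by (rule node_mono[OF node_step1]) (use Y' j in auto)
        then show ?thesis using j by (simp add: \<psi>_def)
      next
        assume j: "j = 2"
        have "node (\<lambda>t. e + (q - c) * sgn (t - y\<^sub>2) + (- q) * sgn (t - 0)) s ((j, s) \<in> snd ` Y')"
          by (rule node_mono[OF node_step2]) (use Y' j in auto)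
        then show ?thesis using j by (simp add: \<psi>_def)
      qed
    next
      fix z w assume "(z, w) \<in> Y'"
      then consider "z = (0, y\<^sub>1)" "w = (1, y\<^sub>1)" | "z = (0, y\<^sub>2)" "w = (2, y\<^sub>2)" | "z = (1, 0)" "w = (2, 0)"
        using Y' by auto
      then show "\<psi> w = \<psi> z"
      proof cases
        case 1
        then show ?thesis by (simp add: \<psi>_def)
      next
        case 2
        then show ?thesis using rel(1) \<sigma>(5) by (simp add: \<psi>_def)
      next
        case 3
        then show ?thesis using rel(1) \<sigma>(4,5) by (simp add: \<psi>_def sgn_minus algebra_simps)
      qed
    qed
    moreover have "\<psi> (j, s) = \<phi> (j, s)" if "j < 3" "d < \<bar>s\<bar> \<and> \<bar>s\<bar> < 1" for j s
    proof -
      have "s \<in> {-1<..<1}" using that by (auto simp: abs_less_iff)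
      note s = bspec[OF \<phi> this]
      have far: "sgn (s - x\<^sub>1) = sgn s" "sgn (s - x\<^sub>2) = sgn s" "sgn (s - y\<^sub>1) = sgn s" "sgn (s - y\<^sub>2) = sgn s"
        using sgn_diff_far d that by blast+
      have p: "p = - c - q" using rel(2) by simp
      show ?thesis
        using cases3[OF that(1)] s unfolding \<psi>_def p by (auto simp: far algebra_simps)
    qed
    ultimately show "\<exists>\<psi>. tangle_coloring 3 Y' \<psi> \<and>
        (\<forall>j<3. \<forall>s. d < \<bar>s\<bar> \<and> \<bar>s\<bar> < 1 \<longrightarrow> \<psi> (j, s) = \<phi> (j, s))"
      by (intro exI[of _ \<psi>]) simp
  next
    fix \<phi> b assume \<phi>: "tangle_coloring 3 Y \<phi>"
      and b: "\<forall>j<3. \<forall>s. d < \<bar>s\<bar> \<and> \<bar>s\<bar> < 1 \<longrightarrow> \<phi> (j, s) = b"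
    from *[OF \<phi>] obtain a c e p q where \<phi>: "\<forall>s\<in>{-1<..<1}. \<phi> (0, s) = a \<and>
        \<phi> (1, s) = a + c * sgn (s - x\<^sub>1) \<and> \<phi> (2, s) = e + p * sgn (s - x\<^sub>2) + q * sgn (s - 0)"
      and rel: "e + q * \<sigma> = a" "p + q = - c"
      by (elim exE conjE)
    let ?s = "(d + 1) / 2"
    have s1: "sgn ?s = 1" using d0' by simp
    have "\<phi> (0, ?s) = b" "\<phi> (1, ?s) = b" "\<phi> (2, ?s) = b" using b d0 by simp_all
    moreover have "?s \<in> {-1<..<1}" using d0 by (simp add: abs_less_iff)
    from bspec[OF \<phi> this] have "\<phi> (0, ?s) = a" "\<phi> (1, ?s) = a + c" "\<phi> (2, ?s) = e + p + q"
      using sgn_diff_far[OF d0(1) d(1)] sgn_diff_far[OF d0(1) d(2)] s1 by simp_all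
    \<comment> \<open>The outer values on one side already suffice: with the two relations they make
      all jump coefficients vanish.\<close>
    ultimately have "a = b" "c = 0" "e + (p + q) = b" by simp_all
    then have "e = b" using rel(2) by simp
    then have "q = 0" using rel(1) \<open>a = b\<close> \<sigma>(1) by simp
    then have "p = 0" using rel(2) \<open>c = 0\<close> by simp
    show "\<forall>j<3. \<forall>s. \<bar>s\<bar> < 1 \<longrightarrow> \<phi> (j, s) = b"
    proof (intro allI impI)
      fix j s assume "j < (3 :: nat)" "\<bar>s\<bar> < (1 :: real)"
      then have "s \<in> {-1<..<1}" by (auto simp: abs_less_iff)
      from bspec[OF \<phi> this] show "\<phi> (j, s) = b"
        using cases3[OF \<open>j < 3\<close>] \<open>a = b\<close> \<open>c = 0\<close> \<open>e = b\<close> \<open>p = 0\<close> \<open>q = 0\<close> by auto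
    qed
  qed
qed

section \<open>Planar isotopies and detour moves\<close>

lemma colorable_cong:
  assumes "ncomp E = ncomp D" "crossing_rel E = crossing_rel D"
  shows "colorable E \<longleftrightarrow> colorable D"
  \<comment> \<open>Colorings see the plane only through \<open>crossing_rel\<close>, so moves that
    preserve this relation preserve the colorings themselves.\<close>
  unfolding colorable_def coloring_def strand_pts_def assms ..

lemma planar_isotopy_colorable:
  assumes "virtual_diagram D" "planar_isotopy D E"
  shows "colorable E \<longleftrightarrow> colorable D"
proof -
  obtain \<phi> where nc: "ncomp E = ncomp D" and ov: "over E = over D"
    and \<phi>: "homotopic_with_canon (\<lambda>f. \<exists>g. homeomorphism UNIV UNIV f g) UNIV UNIV id \<phi>"
    and pos: "\<forall>p\<in>strand_pts D. pos E p = \<phi> (pos D p)"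
    using assms(2) unfolding planar_isotopy_def by (elim exE conjE)
  \<comment> \<open>The end map of the isotopy is again a homeomorphism, so no coincidences of
    points appear or vanish.\<close>
  obtain g where "homeomorphism UNIV UNIV \<phi> g"
    using homotopic_with_imp_property[OF \<phi>] by (elim conjE exE)
  then have "g (\<phi> a) = a" for a by (rule homeomorphism_apply1) simp
  then have inj: "\<phi> a = \<phi> b \<longleftrightarrow> a = b" for a b by metis
  have SE: "strand_pts E = strand_pts D" by (simp add: strand_pts_def nc)
  have "(p, q) \<in> crossing_rel E \<longleftrightarrow> (p, q) \<in> crossing_rel D" for p q
  proof (cases "p \<in> over D \<and> q \<in> strand_pts D")
    case True
    then have "p \<in> strand_pts D" using over_strand[OF assms(1)] by blast
    then have "pos E p = \<phi> (pos D p)" "pos E q = \<phi> (pos D q)" using pos True by simp_all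
    then show ?thesis by (simp add: crossing_rel_def SE ov inj)
  next
    case False
    then show ?thesis by (auto simp: crossing_rel_def SE ov)
  qed
  then have "crossing_rel E = crossing_rel D" by auto
  then show ?thesis using nc by (intro colorable_cong)
qed

lemma detour_move_colorable:
  assumes vd: "virtual_diagram D" "virtual_diagram E" and "detour_move D E"
  shows "colorable E \<longleftrightarrow> colorable D"
proof -
  obtain i a b where nc: "ncomp E = ncomp D" and ov: "over E = over D"
    and arc: "\<forall>t\<in>{a..b}. (i, cis t) \<notin> classical_pts D"
    and off: "\<forall>p\<in>strand_pts D - (\<lambda>t. (i, cis t)) ` {a..b}. pos E p = pos D p"
    using assms(3) unfolding detour_move_def by (elim exE conjE)
  have SE: "strand_pts E = strand_pts D" by (simp add: strand_pts_def nc)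
  have cl: "pos E p = pos D p" if "p \<in> classical_pts D" for p
  proof -
    have "p \<in> strand_pts D" using that classical_pts_strand[OF vd(1)] by blast
    moreover have "p \<notin> (\<lambda>t. (i, cis t)) ` {a..b}" using arc that by auto
    ultimately show ?thesis using off by simp
  qed
  have DE: "(p, q) \<in> crossing_rel E" if pq: "(p, q) \<in> crossing_rel D" for p q
  proof -
    have "p \<in> classical_pts D" "q \<in> classical_pts D"
      using crossing_rel_under[OF vd(1) pq] by (simp_all add: classical_pts_def)
    then have "pos E p = pos D p" "pos E q = pos D q" using cl by simp_all
    then show ?thesis using pq by (simp add: crossing_rel_def ov SE)
  qed
  \<comment> \<open>The over point of a crossing of \<open>E\<close> also belongs to a crossing of
    \<open>D\<close>, which the move keeps. As \<open>E\<close> has no triple points, the under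
    points agree.\<close>
  have "(p, q) \<in> crossing_rel D" if pq: "(p, q) \<in> crossing_rel E" for p q
  proof -
    have "p \<in> over D" using pq by (simp add: crossing_rel_def ov)
    then obtain q' where q': "(p, q') \<in> crossing_rel D" using over_crossing_rel[OF vd(1)] by blast
    then have "q' = q" using crossing_rel_under_unique[OF vd(2) DE[OF q'] pq] by simp
    then show ?thesis using q' by simp
  qed
  then have "crossing_rel E = crossing_rel D" using DE by auto
  then show ?thesis using nc by (intro colorable_cong)
qed

section \<open>Reparametrization and renumbering of the components\<close>

lemma reparametrization_sym:
  assumes "reparametrization D E" shows "reparametrization E D"
proof -
  obtain \<sigma> h k where nc: "ncomp E = ncomp D" and \<sigma>: "bij_betw \<sigma> {..<ncomp D} {..<ncomp D}"
    and hk: "\<forall>i<ncomp D. homeomorphism (sphere 0 1) (sphere 0 1) (h i) (k i) \<and>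
           (\<forall>u\<in>sphere 0 1. curve E (\<sigma> i) (h i u) = curve D i u \<and>
              ((\<sigma> i, h i u) \<in> over E \<longleftrightarrow> (i, u) \<in> over D))"
    using assms unfolding reparametrization_def by (elim exE conjE)
  define \<tau> where "\<tau> = inv_into {..<ncomp D} \<sigma>"
  have \<tau>: "bij_betw \<tau> {..<ncomp D} {..<ncomp D}"
    unfolding \<tau>_def using \<sigma> by (rule bij_betw_inv_into)
  have "homeomorphism (sphere 0 1) (sphere 0 1) (k (\<tau> i)) (h (\<tau> i)) \<and>
      (\<forall>u\<in>sphere 0 1. curve D (\<tau> i) (k (\<tau> i) u) = curve E i u \<and>
         ((\<tau> i, k (\<tau> i) u) \<in> over D \<longleftrightarrow> (i, u) \<in> over E))" if i: "i < ncomp D" for i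
  proof -
    have ti: "\<tau> i < ncomp D" using \<tau> i by (auto simp: bij_betw_def)
    have st: "\<sigma> (\<tau> i) = i"
      unfolding \<tau>_def using bij_betw_inv_into_right[OF \<sigma>] i by simp
    have hom: "homeomorphism (sphere 0 1) (sphere 0 1) (h (\<tau> i)) (k (\<tau> i))"
      and eq: "\<And>u. u \<in> sphere 0 1 \<Longrightarrow> curve E i (h (\<tau> i) u) = curve D (\<tau> i) u \<and>
              ((i, h (\<tau> i) u) \<in> over E \<longleftrightarrow> (\<tau> i, u) \<in> over D)"
      using hk ti st by auto
    have "curve D (\<tau> i) (k (\<tau> i) u) = curve E i u \<and>
         ((\<tau> i, k (\<tau> i) u) \<in> over D \<longleftrightarrow> (i, u) \<in> over E)" if u: "u \<in> sphere 0 1" for u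
    proof -
      have "k (\<tau> i) u \<in> sphere 0 1" using homeomorphism_image2[OF hom] u by blast
      from eq[OF this] show ?thesis using homeomorphism_apply2[OF hom u] by simp
    qed
    then show ?thesis using homeomorphism_symD[OF hom] by blast
  qed
  then show ?thesis
    unfolding reparametrization_def nc using \<tau>
    by (intro conjI exI[of _ \<tau>] exI[of _ "\<lambda>i. k (\<tau> i)"] exI[of _ "\<lambda>i. h (\<tau> i)"]) auto
qed

text \<open>A window of width 2 is shorter than a full turn. It supplies, around any point of a
  circle, an injective path to which \<open>node_arc\<close> applies.\<close>

lemma inj_on_cis: "inj_on cis {\<theta> - 1..\<theta> + 1}"
proof (rule inj_onI)
  fix x y assume xy: "x \<in> {\<theta> - 1..\<theta> + 1}" "y \<in> {\<theta> - 1..\<theta> + 1}" "cis x = cis y"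
  then obtain n :: int where n: "x = y + 2 * pi * n" by (auto elim: cis_eqE)
  have "\<bar>2 * pi * n\<bar> < 2 * pi" using xy n pi_gt3 by auto
  then have "\<bar>real_of_int n\<bar> < 1" by (simp add: abs_mult)
  then show "x = y" using n by simp
qed

text \<open>A coloring of \<open>E\<close> is pulled back along the homeomorphisms of the circles.
  The local condition is carried over by \<open>node_arc\<close>, and the converse implication comes
  from \<open>reparametrization_sym\<close>.\<close>

lemma reparametrization_colorable:
  assumes vd: "virtual_diagram D" "virtual_diagram E" and "reparametrization D E" "colorable E"
  shows "colorable D"
proof -
  obtain \<sigma> h k where nc: "ncomp E = ncomp D" and \<sigma>: "bij_betw \<sigma> {..<ncomp D} {..<ncomp D}"
    and hk: "\<forall>i<ncomp D. homeomorphism (sphere 0 1) (sphere 0 1) (h i) (k i) \<and>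
           (\<forall>u\<in>sphere 0 1. curve E (\<sigma> i) (h i u) = curve D i u \<and>
              ((\<sigma> i, h i u) \<in> over E \<longleftrightarrow> (i, u) \<in> over D))"
    using assms(3) unfolding reparametrization_def by (elim exE conjE)
  have SE: "strand_pts E = strand_pts D" by (simp add: strand_pts_def nc)
  define \<Phi> where "\<Phi> = (\<lambda>(i, u). (\<sigma> i, h i u))"
  have hom: "homeomorphism (sphere 0 1) (sphere 0 1) (h i) (k i)" if "i < ncomp D" for i
    using hk that by blast
  have bij: "bij_betw \<Phi> (strand_pts D) (strand_pts D)"
  proof (rule bij_betw_imageI)
    show "inj_on \<Phi> (strand_pts D)"
    proof (rule inj_onI)
      fix p q assume pq: "p \<in> strand_pts D" "q \<in> strand_pts D" "\<Phi> p = \<Phi> q"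
      obtain i \<theta> where p: "p = (i, cis \<theta>)" "i < ncomp D" using pq(1) by (rule strand_ptsE)
      obtain j \<eta> where q: "q = (j, cis \<eta>)" "j < ncomp D" using pq(2) by (rule strand_ptsE)
      have "\<sigma> i = \<sigma> j" using pq(3) p q by (simp add: \<Phi>_def)
      then have "i = j" using inj_onD[OF bij_betw_imp_inj_on[OF \<sigma>]] p(2) q(2) by simp
      moreover have "h i (cis \<theta>) = h i (cis \<eta>)" using pq(3) p q \<open>i = j\<close> by (simp add: \<Phi>_def)
      then have "k i (h i (cis \<theta>)) = k i (h i (cis \<eta>))" by simp
      then have "cis \<theta> = cis \<eta>" using homeomorphism_apply1[OF hom[OF p(2)]] by simp
      ultimately show "p = q" using p q by simp
    qed
    show "\<Phi> ` strand_pts D = strand_pts D"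
    proof
      show "\<Phi> ` strand_pts D \<subseteq> strand_pts D"
      proof
        fix p assume "p \<in> \<Phi> ` strand_pts D"
        then obtain q where q: "q \<in> strand_pts D" "p = \<Phi> q" by blast
        obtain i u where "q = (i, u)" "i < ncomp D" "u \<in> sphere 0 1"
          using q(1) by (auto simp: strand_pts_def)
        then have iu: "p = (\<sigma> i, h i u)" "i < ncomp D" "u \<in> sphere 0 1"
          using q(2) by (simp_all add: \<Phi>_def)
        have "\<sigma> i \<in> {..<ncomp D}" using bij_betw_apply[OF \<sigma>] iu(2) by simp
        moreover have "h i u \<in> sphere 0 1" using homeomorphism_image1[OF hom[OF iu(2)]] iu(3) by blast
        ultimately show "p \<in> strand_pts D" using iu(1) by (simp add: strand_pts_def)
      qed
      show "strand_pts D \<subseteq> \<Phi> ` strand_pts D"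
      proof
        fix p assume "p \<in> strand_pts D"
        then obtain j v where jv: "p = (j, v)" "j \<in> {..<ncomp D}" "v \<in> sphere 0 1"
          unfolding strand_pts_def by (elim SigmaE)
        obtain i where i: "i < ncomp D" "j = \<sigma> i"
          using jv(2) bij_betw_imp_surj_on[OF \<sigma>] by blast
        obtain u where "u \<in> sphere 0 1" "v = h i u"
          using jv(3) homeomorphism_image1[OF hom[OF i(1)]] by blast
        then have "p = \<Phi> (i, u)" "(i, u) \<in> strand_pts D" using jv i by (simp_all add: \<Phi>_def strand_pts_def)
        then show "p \<in> \<Phi> ` strand_pts D" by blast
      qed
    qed
  qed
  note surj = bij_betw_imp_surj_on[OF bij]
  have \<Phi>S: "\<Phi> p \<in> strand_pts D" if "p \<in> strand_pts D" for p using bij_betw_apply[OF bij that] .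
  have pos: "pos E (\<Phi> p) = pos D p" "\<Phi> p \<in> over E \<longleftrightarrow> p \<in> over D" if "p \<in> strand_pts D" for p
  proof -
    obtain i u where iu: "p = (i, u)" "i < ncomp D" "u \<in> sphere 0 1"
      using \<open>p \<in> _\<close> unfolding strand_pts_def by (metis SigmaE lessThan_iff)
    then show "pos E (\<Phi> p) = pos D p" "\<Phi> p \<in> over E \<longleftrightarrow> p \<in> over D"
      using hk by (simp_all add: \<Phi>_def pos_def)
  qed
  have cr: "(\<Phi> p, \<Phi> q) \<in> crossing_rel E \<longleftrightarrow> (p, q) \<in> crossing_rel D"
    if "p \<in> strand_pts D" "q \<in> strand_pts D" for p q
    unfolding crossing_rel_def mem_Collect_eq case_prod_conv SE
      pos(1)[OF that(1)] pos(1)[OF that(2)] pos(2)[OF that(1)]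
      inj_on_eq_iff[OF bij_betw_imp_inj_on[OF bij] that(2,1)]
    using that(2) \<Phi>S[OF that(2)] by simp
  obtain f where f: "coloring E f" "\<not> f constant_on strand_pts E"
    using assms(4) unfolding colorable_def by (elim exE conjE)
  have "coloring D (f \<circ> \<Phi>)"
    unfolding coloring_def
  proof (intro conjI allI impI)
    fix i \<theta> assume i: "i < ncomp D"
    then have p: "(i, cis \<theta>) \<in> strand_pts D" by simp
    have h1: "h i (cis t) \<in> sphere 0 1" for t
    proof -
      have "h i (cis t) \<in> h i ` sphere 0 1" by (rule imageI) simp
      then show ?thesis by (simp only: homeomorphism_image1[OF hom[OF i]])
    qed
    obtain \<eta> where \<eta>: "h i (cis \<theta>) = cis \<eta>" using unit_circle_cis[OF h1] .
    then have \<Phi>\<theta>: "\<Phi> (i, cis \<theta>) = (\<sigma> i, cis \<eta>)" by (simp add: \<Phi>_def)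
    have \<sigma>i: "\<sigma> i < ncomp E" using bij_betw_apply[OF \<sigma>] i nc by simp
    have "node (\<lambda>t. f (\<sigma> i, cis t)) \<eta> ((\<sigma> i, cis \<eta>) \<in> snd ` crossing_rel E)"
      using f(1) \<sigma>i by (simp add: coloring_def)
    moreover have "node (\<lambda>t. f (\<sigma> i, h i (cis t))) \<theta> e \<longleftrightarrow> node (\<lambda>t. f (\<sigma> i, cis t)) \<eta> e" for e
    proof (rule node_arc[where F="\<lambda>z. f (\<sigma> i, z)" and a="\<theta> - 1" and b="\<theta> + 1"])
      show "continuous_on {\<theta> - 1..\<theta> + 1} (\<lambda>t. h i (cis t))"
        by (rule continuous_on_compose2[OF homeomorphism_cont1[OF hom[OF i]]])
          (auto intro: continuous_intros)
      show "inj_on (\<lambda>t. h i (cis t)) {\<theta> - 1..\<theta> + 1}"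
      proof (rule inj_onI)
        fix x y assume xy: "x \<in> {\<theta> - 1..\<theta> + 1}" "y \<in> {\<theta> - 1..\<theta> + 1}" "h i (cis x) = h i (cis y)"
        have "cis x = k i (h i (cis x))" "cis y = k i (h i (cis y))"
          using homeomorphism_apply1[OF hom[OF i]] by simp_all
        then have "cis x = cis y" using xy(3) by metis
        then show "x = y" using inj_onD[OF inj_on_cis[of \<theta>]] xy(1,2) by simp
      qed
      show "(\<lambda>t. h i (cis t)) ` {\<theta> - 1..\<theta> + 1} \<subseteq> sphere 0 1"
        using h1 by (rule image_subsetI)
    qed (simp_all add: \<eta>)
    ultimately have "node (\<lambda>t. (f \<circ> \<Phi>) (i, cis t)) \<theta> ((\<sigma> i, cis \<eta>) \<in> snd ` crossing_rel E)"
      by (simp add: \<Phi>_def)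
    then show "node (\<lambda>t. (f \<circ> \<Phi>) (i, cis t)) \<theta> ((i, cis \<theta>) \<in> snd ` crossing_rel D)"
    proof (rule node_mono)
      assume "(\<sigma> i, cis \<eta>) \<in> snd ` crossing_rel E"
      then obtain q where q: "(q, \<Phi> (i, cis \<theta>)) \<in> crossing_rel E" unfolding \<Phi>\<theta> by auto
      then have "q \<in> strand_pts D" using crossing_relD(1)[OF vd(2) q] SE by simp
      then have "q \<in> \<Phi> ` strand_pts D" by (simp only: surj)
      then obtain o' where o: "o' \<in> strand_pts D" "q = \<Phi> o'" by blast
      then have "(o', (i, cis \<theta>)) \<in> crossing_rel D" using q cr[OF o(1) p] by simp
      then show "(i, cis \<theta>) \<in> snd ` crossing_rel D" by (rule image_eqI[rotated]) simp
    qed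
  next
    fix p q assume pq: "(p, q) \<in> crossing_rel D"
    then have "(\<Phi> p, \<Phi> q) \<in> crossing_rel E" using cr[OF crossing_relD(1,2)[OF vd(1) pq]] by simp
    from coloring_crossing[OF f(1) this] show "(f \<circ> \<Phi>) q = (f \<circ> \<Phi>) p" by simp
  qed
  moreover have "\<not> (f \<circ> \<Phi>) constant_on strand_pts D"
  proof
    assume "(f \<circ> \<Phi>) constant_on strand_pts D"
    then obtain c where c: "\<forall>p\<in>strand_pts D. f (\<Phi> p) = c" by (auto simp: constant_on_def)
    have "f q = c" if "q \<in> strand_pts E" for q
    proof -
      have "q \<in> \<Phi> ` strand_pts D" using that by (simp only: surj SE)
      then obtain p where "p \<in> strand_pts D" "q = \<Phi> p" by blast
      then show ?thesis using c by simp
    qed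
    then have "f constant_on strand_pts E" unfolding constant_on_def by (intro exI ballI)
    then show False using f(2) by blast
  qed
  ultimately show ?thesis unfolding colorable_def by (intro exI conjI)
qed

section \<open>Reidemeister moves\<close>

lemma local_move_colorable_iff:
  assumes vd: "virtual_diagram D" "virtual_diagram E" and lm: "local_move m f F g G D E"
    and sq: "\<And>j s. j < m \<Longrightarrow> s \<in> {-1..1} \<Longrightarrow> f j s \<in> square"
      "\<And>j s. j < m \<Longrightarrow> s \<in> {-1..1} \<Longrightarrow> g j s \<in> square"
    and Y: "tangle_rel m f F = Y" "tangle_rel m g G = Y'"
    and d: "d < 1" "\<And>x y. (x, y) \<in> Y \<union> Y' \<Longrightarrow> \<bar>snd x\<bar> \<le> d \<and> \<bar>snd y\<bar> \<le> d"
    and sim: "tangle_sim m d Y Y'" "tangle_sim m d Y' Y"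
  shows "colorable E \<longleftrightarrow> colorable D"
proof
  assume "colorable D"
  show "colorable E"
  proof (rule local_move_colorable[OF vd lm sq d(1) _ _ \<open>colorable D\<close>])
    show "tangle_sim m d (tangle_rel m f F) (tangle_rel m g G)" unfolding Y by (rule sim(1))
  qed (use d(2) Y in auto)
next
  assume "colorable E"
  show "colorable D"
  proof (rule local_move_colorable[OF vd(2,1) local_move_sym[OF lm] sq(2,1) d(1) _ _ \<open>colorable E\<close>])
    show "tangle_sim m d (tangle_rel m g G) (tangle_rel m f F)" unfolding Y by (rule sim(2))
  qed (use d(2) Y in auto)
qed

lemma in_tangle_rel:
  "((j, s), (k, t)) \<in> tangle_rel m f F \<longleftrightarrow> j < m \<and> s \<in> {-1..1} \<and> k < m \<and> t \<in> {-1..1} \<and>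
     (j, s) \<in> F \<and> (k, t) \<noteq> (j, s) \<and> f k t = f j s"
  by (auto simp: tangle_rel_def)

lemma reidemeister1_colorable:
  assumes vd: "virtual_diagram D" "virtual_diagram E" and "reidemeister1 D E"
  shows "colorable E \<longleftrightarrow> colorable D"
proof -
  obtain \<kappa> s\<^sub>1 s\<^sub>2 s where \<kappa>: "\<kappa> (-1) = -1" "\<kappa> 1 = 1" "\<kappa> ` {-1<..<1} \<subseteq> interior square"
    and s: "-1 < s\<^sub>1" "s\<^sub>1 < s\<^sub>2" "s\<^sub>2 < 1" "s \<in> {s\<^sub>1, s\<^sub>2}"
    and dbl: "\<forall>x\<in>{-1..1}. \<forall>y\<in>{-1..1}. x < y \<longrightarrow> (\<kappa> x = \<kappa> y \<longleftrightarrow> x = s\<^sub>1 \<and> y = s\<^sub>2)"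
    and lm: "local_move 1 (\<lambda>_. \<kappa>) {(0, s)} (\<lambda>_. complex_of_real) {} D E"
    using assms(3) unfolding reidemeister1_def by (elim exE conjE)
  \<comment> \<open>This is the parameter of the under passage, the one of \<open>s\<^sub>1\<close>,
    \<open>s\<^sub>2\<close> other than \<open>s\<close>.\<close>
  define t where "t = s\<^sub>1 + s\<^sub>2 - s"
  have st: "(s = s\<^sub>1 \<and> t = s\<^sub>2) \<or> (s = s\<^sub>2 \<and> t = s\<^sub>1)" using s(4) by (auto simp: t_def)
  then have "s \<noteq> t" using s(2) by auto
  have in1: "s \<in> {-1..1}" "t \<in> {-1..1}" using st s by auto
  have eq: "\<kappa> r = \<kappa> s \<longleftrightarrow> r = t" if "r \<in> {-1..1}" "r \<noteq> s" for r
  proof (cases "r < s")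
    case True
    then have "\<kappa> r = \<kappa> s \<longleftrightarrow> r = s\<^sub>1 \<and> s = s\<^sub>2" using dbl that(1) in1(1) by blast
    then show ?thesis using st s(2) True by auto
  next
    case False
    then have "s < r" using that(2) by simp
    then have "\<kappa> s = \<kappa> r \<longleftrightarrow> s = s\<^sub>1 \<and> r = s\<^sub>2" using dbl that(1) in1(1) by blast
    then show ?thesis using st s(2) \<open>s < r\<close> by auto
  qed
  define d where "d = max \<bar>s\<bar> \<bar>t\<bar>"
  have d: "\<bar>s\<bar> \<le> d" "\<bar>t\<bar> \<le> d" "d < 1" using st s by (auto simp: d_def)
  show ?thesis
  proof (rule local_move_colorable_iff[OF vd lm])
    show "\<kappa> r \<in> square" if r: "r \<in> {-1..1}" for r
    proof (cases "r \<in> {-1<..<1}")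
      case True
      then show ?thesis using \<kappa>(3) interior_subset by blast
    next
      case False
      then have "r = -1 \<or> r = 1" using r by auto
      then show ?thesis using \<kappa>(1,2) by (auto simp: square_def)
    qed
    show "complex_of_real r \<in> square" if "r \<in> {-1..1}" for r :: real
      using that by (auto simp: square_def abs_le_iff)
    show "tangle_rel 1 (\<lambda>_. \<kappa>) {(0, s)} = {((0, s), (0, t))}"
    proof (intro set_eqI iffI)
      fix z assume "z \<in> tangle_rel 1 (\<lambda>_. \<kappa>) {(0, s)}"
      moreover obtain j s' k r where z': "z = ((j, s'), (k, r))" by (metis prod.collapse)
      ultimately have z: "z = ((0, s), (0, r))" and r: "r \<in> {-1..1}" "r \<noteq> s" "\<kappa> r = \<kappa> s"
        by (auto simp: in_tangle_rel)
      then show "z \<in> {((0, s), (0, t))}" using eq by simp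
    next
      fix z :: "(nat \<times> real) \<times> (nat \<times> real)" assume "z \<in> {((0, s), (0, t))}"
      moreover have "\<kappa> t = \<kappa> s" using eq[OF in1(2)] \<open>s \<noteq> t\<close> by simp
      ultimately show "z \<in> tangle_rel 1 (\<lambda>_. \<kappa>) {(0, s)}"
        using in1 \<open>s \<noteq> t\<close> by (simp add: tangle_rel_def)
    qed
    show "tangle_rel 1 (\<lambda>_. complex_of_real) {} = {}" by (auto simp: tangle_rel_def)
    show "tangle_sim 1 d {((0, s), (0, t))} {}" by (rule R1_sim[OF d \<open>s \<noteq> t\<close>]) simp
    show "tangle_sim 1 d {} {((0, s), (0, t))}" by (rule R1_sim[OF d \<open>s \<noteq> t\<close>]) simp
  qed (use d in auto)
qed

lemma reidemeister2_colorable: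
  assumes vd: "virtual_diagram D" "virtual_diagram E" and "reidemeister2 D E"
  shows "colorable E \<longleftrightarrow> colorable D"
proof -
  obtain u v m where uv: "\<forall>s\<in>{-1..1}. \<bar>u s\<bar> < 1 \<and> 0 < v s \<and> v s < 1"
      "u (-1) = v (-1)" "u 1 = v 1"
    and card: "card {s\<in>{-1..1}. u s = 0} = 2" and m: "m \<in> {0, 1}"
    and lm: "local_move 2
          (\<lambda>j s. if j = 0 then Complex s 0 else Complex s (u s)) ({m} \<times> {s\<in>{-1..1}. u s = 0})
          (\<lambda>j s. if j = 0 then Complex s 0 else Complex s (v s)) {} D E"
    using assms(3) unfolding reidemeister2_def by (elim exE conjE)
  obtain x y where xy: "{s\<in>{-1..1}. u s = 0} = {x, y}" "x < y"
  proof -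
    obtain a b where "{s\<in>{-1..1}. u s = 0} = {a, b}" "a \<noteq> b"
      using card by (auto simp: card_2_iff)
    then show ?thesis using that[of a b] that[of b a] by (cases "a < b") (auto simp: insert_commute)
  qed
  have z: "s \<in> {-1..1} \<and> u s = 0 \<longleftrightarrow> s = x \<or> s = y" for s
    using xy(1) by blast
  \<comment> \<open>At the ends \<open>u\<close> agrees with \<open>v\<close>, which is positive. So
    the zeros of \<open>u\<close> are inner parameters and there is a radius \<open>d < 1\<close>
    beyond them.\<close>
  have "u (-1) \<noteq> 0" "u 1 \<noteq> 0"
    using uv(2,3) bspec[OF uv(1), of "-1"] bspec[OF uv(1), of 1] by auto
  then have "x \<noteq> -1" "x \<noteq> 1" "y \<noteq> -1" "y \<noteq> 1" using z[of x] z[of y] by auto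
  then have ab: "\<bar>x\<bar> < 1" "\<bar>y\<bar> < 1" using z[of x] z[of y] by auto
  define d where "d = max \<bar>x\<bar> \<bar>y\<bar>"
  have d: "\<bar>x\<bar> \<le> d" "\<bar>y\<bar> \<le> d" "d < 1" using ab by (auto simp: d_def)
  define n :: nat where "n = 1 - m"
  have mn: "{m, n} = {0, 1}" "m \<noteq> n" using m by (auto simp: n_def)
  define Y where "Y = {((m, x), (n, x)), ((m, y), (n, y))}"
  show ?thesis
  proof (rule local_move_colorable_iff[OF vd lm])
    show "(if j = 0 then Complex s 0 else Complex s (u s)) \<in> square" if "s \<in> {-1..1}" for j :: nat and s
      using that bspec[OF uv(1) that] by (auto simp: square_def abs_le_iff)
    show "(if j = 0 then Complex s 0 else Complex s (v s)) \<in> square" if "s \<in> {-1..1}" for j :: nat and s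
      using that bspec[OF uv(1) that] by (auto simp: square_def abs_le_iff)
    show "tangle_rel 2 (\<lambda>j s. if j = 0 then Complex s 0 else Complex s (u s))
        ({m} \<times> {s\<in>{-1..1}. u s = 0}) = Y"
    proof (intro set_eqI iffI)
      fix w assume w: "w \<in> tangle_rel 2 (\<lambda>j s. if j = 0 then Complex s 0 else Complex s (u s))
        ({m} \<times> {s\<in>{-1..1}. u s = 0})"
      obtain j s k t where jk: "w = ((j, s), (k, t))" by (metis prod.collapse)
      have "j = m" "s \<in> {-1..1} \<and> u s = 0" "k < 2" "(k, t) \<noteq> (j, s)"
          "(if k = 0 then Complex t 0 else Complex t (u t)) = (if j = 0 then Complex s 0 else Complex s (u s))"
        using w unfolding jk in_tangle_rel by blast+
      moreover from this have "t = s" by (auto split: if_splits)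
      ultimately have "k = n" "s = x \<or> s = y"
        using m z[of s] by (auto simp: n_def less_2_cases_iff)
      then show "w \<in> Y" using jk \<open>t = s\<close> \<open>j = m\<close> by (auto simp: Y_def)
    next
      fix w assume "w \<in> Y"
      then obtain s where w: "w = ((m, s), (n, s))" and s: "s = x \<or> s = y" by (auto simp: Y_def)
      have "s \<in> {-1..1}" "u s = 0" using s z[of s] by auto
      then show "w \<in> tangle_rel 2 (\<lambda>j s. if j = 0 then Complex s 0 else Complex s (u s))
        ({m} \<times> {s\<in>{-1..1}. u s = 0})"
        using m by (auto simp: w tangle_rel_def n_def)
    qed
    show "tangle_rel 2 (\<lambda>j s. if j = 0 then Complex s 0 else Complex s (v s)) {} = {}"
      by (auto simp: tangle_rel_def)
    show "tangle_sim 2 d Y {}" by (rule R2_sim_remove[OF d xy(2) mn Y_def])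
    show "tangle_sim 2 d {} Y" by (rule R2_sim_create[OF d xy(2) mn Y_def])
  qed (use d in \<open>auto simp: Y_def\<close>)
qed

text \<open>All strands are graphs over the real axis and so meet at equal parameters only. The
  condition \<open>u 0 \<noteq> 0\<close> keeps the top strand off the crossing of the other
  two.\<close>

lemma R3_tangle_rel:
  fixes u :: "real \<Rightarrow> real"
  assumes x: "\<And>s. s \<in> {-1..1} \<and> u s = s/2 \<longleftrightarrow> s = x\<^sub>1" "\<And>s. s \<in> {-1..1} \<and> u s = - s/2 \<longleftrightarrow> s = x\<^sub>2"
    and "u 0 \<noteq> 0"
  shows "tangle_rel 3 (\<lambda>j s. Complex s (if j = 0 then u s else if j = 1 then s/2 else - s/2))
      ({0} \<times> {s\<in>{-1..1}. u s = s/2 \<or> u s = - s/2} \<union> {(1, 0)}) =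
    {((0, x\<^sub>1), (1, x\<^sub>1)), ((0, x\<^sub>2), (2, x\<^sub>2)), ((1, 0), (2, 0))}" (is "tangle_rel 3 ?f ?F = ?Y")
proof (intro set_eqI iffI)
  fix w assume w: "w \<in> tangle_rel 3 ?f ?F"
  obtain j s k t where jk: "w = ((j, s), (k, t))" by (metis prod.collapse)
  have 1: "(j, s) \<in> ?F" "s \<in> {-1..1}" "k < 3" "(k, t) \<noteq> (j, s)" "?f k t = ?f j s"
    using w unfolding jk in_tangle_rel by blast+
  have ts: "t = s" using 1(5) by simp
  have k: "k = 0 \<or> k = 1 \<or> k = 2" using 1(3) by auto
  show "w \<in> ?Y"
  proof (cases "j = 0")
    case True
    then have "k = 1 \<or> k = 2" using 1(4) ts k by auto
    then show ?thesis
    proof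
      assume "k = 1"
      then have "u s = s/2" using 1(5) ts True by simp
      then have "s = x\<^sub>1" using x(1)[of s] 1(2) by blast
      then show ?thesis using jk ts True \<open>k = 1\<close> by simp
    next
      assume "k = 2"
      then have "u s = - s/2" using 1(5) ts True by simp
      then have "s = x\<^sub>2" using x(2)[of s] 1(2) by blast
      then show ?thesis using jk ts True \<open>k = 2\<close> by simp
    qed
  next
    case False
    then have j: "j = 1" "s = 0" using 1(1) by auto
    then have "k \<noteq> 1" using 1(4) ts by auto
    moreover have "k \<noteq> 0"
    proof
      assume "k = 0"
      then have "u 0 = 0" using 1(5) ts j by simp
      then show False using assms(3) by simp
    qed
    ultimately show ?thesis using k jk ts j by simp
  qed
next
  fix w assume "w \<in> ?Y"
  then consider "w = ((0, x\<^sub>1), (1, x\<^sub>1))" | "w = ((0, x\<^sub>2), (2, x\<^sub>2))" | "w = ((1, 0), (2, 0))" by auto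
  then show "w \<in> tangle_rel 3 ?f ?F"
  proof cases
    case 1
    then show ?thesis using x(1)[of x\<^sub>1] by (simp add: tangle_rel_def)
  next
    case 2
    then show ?thesis using x(2)[of x\<^sub>2] by (simp add: tangle_rel_def)
  next
    case 3
    then show ?thesis by (simp add: tangle_rel_def)
  qed
qed

lemma zero_in_open_interval:
  fixes w :: "real \<Rightarrow> real"
  assumes "continuous_on {a..b} w" "a < b" "w a * w b < 0"
  obtains s where "a < s" "s < b" "w s = 0"
proof -
  have "\<exists>s. a \<le> s \<and> s \<le> b \<and> w s = 0"
  proof (cases "w a < 0")
    case True
    then have "w b > 0" using assms(3) by (auto simp: mult_less_0_iff)
    then show ?thesis using IVT'[of w a 0 b] assms True by auto
  next
    case False
    then have "w a > 0" "w b < 0" using assms(3) by (auto simp: mult_less_0_iff)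
    then show ?thesis using IVT2'[of w b 0 a] assms by auto
  qed
  then obtain s where s: "a \<le> s" "s \<le> b" "w s = 0" by (elim exE conjE)
  have "s \<noteq> a" "s \<noteq> b" using s(3) assms(3) by auto
  then show ?thesis using that[of s] s by simp
qed

lemma reidemeister3_colorable:
  assumes vd: "virtual_diagram D" "virtual_diagram E" and "reidemeister3 D E"
  shows "colorable E \<longleftrightarrow> colorable D"
proof -
  obtain u v where cont: "continuous_on {-1..1} u" "continuous_on {-1..1} v"
    and bd: "\<forall>s\<in>{-1..1}. \<bar>u s\<bar> < 1 \<and> \<bar>v s\<bar> < 1"
    and ends: "u (-1) = v (-1)" "u 1 = v 1" "\<bar>u (-1)\<bar> < 1/2" "\<bar>u 1\<bar> < 1/2" "0 < u 0" "v 0 < 0"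
    and ex: "\<exists>!s. s \<in> {-1..1} \<and> u s = s/2" "\<exists>!s. s \<in> {-1..1} \<and> u s = - s/2"
      "\<exists>!s. s \<in> {-1..1} \<and> v s = s/2" "\<exists>!s. s \<in> {-1..1} \<and> v s = - s/2"
    and lm: "local_move 3
          (\<lambda>j s. Complex s (if j = 0 then u s else if j = 1 then s/2 else - s/2))
          ({0} \<times> {s\<in>{-1..1}. u s = s/2 \<or> u s = - s/2} \<union> {(1, 0)})
          (\<lambda>j s. Complex s (if j = 0 then v s else if j = 1 then s/2 else - s/2))
          ({0} \<times> {s\<in>{-1..1}. v s = s/2 \<or> v s = - s/2} \<union> {(1, 0)}) D E"
    using assms(3) unfolding reidemeister3_def by (elim exE conjE)
  have cu: "continuous_on {a..b} u" and cv: "continuous_on {a..b} v" if "{a..b} \<subseteq> {-1..1}" for a b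
    using cont that by (auto intro: continuous_on_subset)
  have unique: "\<And>s. P s \<longleftrightarrow> s = x" if "\<exists>!s. P s" "P x" for P :: "real \<Rightarrow> bool" and x
    using that by blast
  \<comment> \<open>At both ends \<open>u\<close> and \<open>v\<close> lie between the two straight
    strands, while at 0 \<open>u\<close> is above their crossing and \<open>v\<close> below it. The
    intermediate value theorem therefore puts each meeting point on a definite side of 0, opposite
    for \<open>u\<close> and \<open>v\<close>; these are the signs that \<open>R3_sim\<close>
    needs.\<close>
  have "continuous_on {0..1} (\<lambda>s. u s - s/2)" by (intro continuous_intros cu) auto
  moreover have "(u 0 - 0/2) * (u 1 - 1/2) < 0" using ends by (intro mult_pos_neg) auto
  ultimately obtain x\<^sub>1 where x1: "0 < x\<^sub>1" "x\<^sub>1 < 1" "u x\<^sub>1 - x\<^sub>1/2 = 0"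
    using zero_in_open_interval[of 0 1 "\<lambda>s. u s - s/2"] by auto
  have "continuous_on {-1..0} (\<lambda>s. u s + s/2)" by (intro continuous_intros cu) auto
  moreover have "(u (-1) + (-1)/2) * (u 0 + 0/2) < 0" using ends by (intro mult_neg_pos) auto
  ultimately obtain x\<^sub>2 where x2: "-1 < x\<^sub>2" "x\<^sub>2 < 0" "u x\<^sub>2 + x\<^sub>2/2 = 0"
    using zero_in_open_interval[of "-1" 0 "\<lambda>s. u s + s/2"] by auto
  have "continuous_on {-1..0} (\<lambda>s. v s - s/2)" by (intro continuous_intros cv) auto
  moreover have "(v (-1) - (-1)/2) * (v 0 - 0/2) < 0" using ends by (intro mult_pos_neg) auto
  ultimately obtain y\<^sub>1 where y1: "-1 < y\<^sub>1" "y\<^sub>1 < 0" "v y\<^sub>1 - y\<^sub>1/2 = 0"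
    using zero_in_open_interval[of "-1" 0 "\<lambda>s. v s - s/2"] by auto
  have "continuous_on {0..1} (\<lambda>s. v s + s/2)" by (intro continuous_intros cv) auto
  moreover have "(v 0 + 0/2) * (v 1 + 1/2) < 0" using ends by (intro mult_neg_pos) auto
  ultimately obtain y\<^sub>2 where y2: "0 < y\<^sub>2" "y\<^sub>2 < 1" "v y\<^sub>2 + y\<^sub>2/2 = 0"
    using zero_in_open_interval[of 0 1 "\<lambda>s. v s + s/2"] by auto
  define d where "d = max (max \<bar>x\<^sub>1\<bar> \<bar>x\<^sub>2\<bar>) (max \<bar>y\<^sub>1\<bar> \<bar>y\<^sub>2\<bar>)"
  have d: "\<bar>x\<^sub>1\<bar> \<le> d" "\<bar>x\<^sub>2\<bar> \<le> d" "\<bar>y\<^sub>1\<bar> \<le> d" "\<bar>y\<^sub>2\<bar> \<le> d" "d < 1" "0 \<le> d"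
    using x1 x2 y1 y2 by (auto simp: d_def)
  define X where "X = {((0::nat, x\<^sub>1), (1::nat, x\<^sub>1)), ((0, x\<^sub>2), (2, x\<^sub>2)), ((1, 0), (2, 0))}"
  define Y where "Y = {((0::nat, y\<^sub>1), (1::nat, y\<^sub>1)), ((0, y\<^sub>2), (2, y\<^sub>2)), ((1, 0), (2, 0))}"
  have sgns: "sgn x\<^sub>1 = 1" "sgn x\<^sub>2 = -1" "sgn y\<^sub>1 = -1" "sgn y\<^sub>2 = 1" using x1 x2 y1 y2 by auto
  show ?thesis
  proof (rule local_move_colorable_iff[OF vd lm])
    show "Complex s (if j = 0 then u s else if j = 1 then s/2 else - s/2) \<in> square"
      if "s \<in> {-1..1}" for j :: nat and s
      using that bspec[OF bd that] by (auto simp: square_def abs_le_iff)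
    show "Complex s (if j = 0 then v s else if j = 1 then s/2 else - s/2) \<in> square"
      if "s \<in> {-1..1}" for j :: nat and s
      using that bspec[OF bd that] by (auto simp: square_def abs_le_iff)
    show "tangle_rel 3 (\<lambda>j s. Complex s (if j = 0 then u s else if j = 1 then s/2 else - s/2))
      ({0} \<times> {s\<in>{-1..1}. u s = s/2 \<or> u s = - s/2} \<union> {(1, 0)}) = X"
      unfolding X_def
    proof (rule R3_tangle_rel)
      show "s \<in> {-1..1} \<and> u s = s/2 \<longleftrightarrow> s = x\<^sub>1" for s
        by (rule unique[OF ex(1)]) (use x1 in auto)
      show "s \<in> {-1..1} \<and> u s = - s/2 \<longleftrightarrow> s = x\<^sub>2" for s
        by (rule unique[OF ex(2)]) (use x2 in auto)
    qed (use ends in simp)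
    show "tangle_rel 3 (\<lambda>j s. Complex s (if j = 0 then v s else if j = 1 then s/2 else - s/2))
      ({0} \<times> {s\<in>{-1..1}. v s = s/2 \<or> v s = - s/2} \<union> {(1, 0)}) = Y"
      unfolding Y_def
    proof (rule R3_tangle_rel)
      show "s \<in> {-1..1} \<and> v s = s/2 \<longleftrightarrow> s = y\<^sub>1" for s
        by (rule unique[OF ex(3)]) (use y1 in auto)
      show "s \<in> {-1..1} \<and> v s = - s/2 \<longleftrightarrow> s = y\<^sub>2" for s
        by (rule unique[OF ex(4)]) (use y2 in auto)
    qed (use ends in simp)
    \<comment> \<open>The sign is that of the parameter at which the top strand crosses the bottom
      strand in the first tangle: \<open>x\<^sub>2\<close> here, \<open>y\<^sub>2\<close> for the
      converse.\<close>
    show "tangle_sim 3 d X Y"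
      by (rule R3_sim[where \<sigma>="-1", OF d(1-5) _ _ _ _ _ X_def Y_def]) (simp_all add: sgns)
    show "tangle_sim 3 d Y X"
      by (rule R3_sim[where \<sigma>=1, OF d(3,4,1,2,5) _ _ _ _ _ Y_def X_def]) (simp_all add: sgns)
  qed (use d in \<open>auto simp: X_def Y_def\<close>)
qed

section \<open>Colorability as an invariant of virtual links\<close>

lemma diagram_move_colorable:
  assumes "diagram_move D E"
  shows "colorable E \<longleftrightarrow> colorable D"
proof -
  have vd: "virtual_diagram D" "virtual_diagram E" using assms by (simp_all add: diagram_move_def)
  from assms consider "reparametrization D E" | "planar_isotopy D E" | "detour_move D E"
    | "reidemeister1 D E" | "reidemeister2 D E" | "reidemeister3 D E"
    unfolding diagram_move_def by (elim conjE disjE)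
  then show ?thesis
  proof cases
    case 1
    then show ?thesis
      using reparametrization_colorable[OF vd] reparametrization_colorable[OF vd(2,1) reparametrization_sym]
      by (intro iffI)
  qed (use vd planar_isotopy_colorable detour_move_colorable reidemeister1_colorable
      reidemeister2_colorable reidemeister3_colorable in \<open>simp_all\<close>)
qed

lemma diagram_equiv_colorable:
  assumes "diagram_equiv D E"
  shows "colorable E \<longleftrightarrow> colorable D"
  using assms unfolding diagram_equiv_def
proof (induction rule: equivclp_induct)
  case (step y z)
  then show ?case using diagram_move_colorable[of y z] diagram_move_colorable[of z y] by auto
qed simp

theorem corollary1p12:
  fixes L :: "vdiagram set" and D :: vdiagram
  assumes "virtual_link L"
    and "D \<in> L"
    and "alternating D"
    and "\<forall>c\<in>classical_crossings D. \<not> nugatory D c"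
  shows "split_link L \<longleftrightarrow> split_diagram D"
proof
  assume "split_link L"
  then obtain E where E: "E \<in> L" "split_diagram E" unfolding split_link_def by blast
  obtain D\<^sub>0 where L: "L = {E. virtual_diagram E \<and> diagram_equiv D\<^sub>0 E}"
    using assms(1) unfolding virtual_link_def by blast
  have vd: "virtual_diagram D" "virtual_diagram E" and
    equiv: "diagram_equiv D\<^sub>0 D" "diagram_equiv D\<^sub>0 E"
    using E(1) assms(2) unfolding L by simp_all
  have "colorable E" using split_colorable[OF vd(2) E(2)] .
  then have "colorable D"
    using diagram_equiv_colorable[OF equiv(1)] diagram_equiv_colorable[OF equiv(2)] by simp
  then show "split_diagram D" by (rule alternating_colorable_split[OF vd(1) assms(3)])
next
  assume "split_diagram D"
  then show "split_link L" using assms(2) unfolding split_link_def by blast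
qed

end
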